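(* Let $\mu$ be a definable measure on a sort $X$ of a complete theory $T$ in a countable language, satisfying Fubini, and let $M\models T$. For $u\subseteq\{1,\dots,n\}$ let $L_u(M)$ be the measure algebra of formulas over $M$ in the variables $(x_i)_{i\in u}$ (with the measure induced by iterated expectation), embedded naturally in $L_{\{1,\dots,n\}}(M)$. Then the family $(L_u(M))_{u\subseteq\{1,\dots,n\}}$ (equivalently, the measure spaces $S_{x_1,\dots,x_n}(M)$ and their projections) forms an independent system: for each $u$, $L_u(M)$ is independent from the $\sigma$-algebra generated by $\bigcup\{L_v(M): u\not\subseteq v\}$ over the $\sigma$-algebra generated by $\bigcup\{L_w(M): w\subsetneq u\}$.
   Context: A definable measure on $X$ is given by expectation quantifiers $E_x$; the iterated measures on $X^n$ come from $E_{x_1}\cdots E_{x_n}$, and Fubini means these iterated expectations do not depend on the order of the variables. $\sigma$-algebras $\mathcal A,\mathcal B$ are independent over $\mathcal C$ if $E(fg\mid\mathcal C)=E(f\mid\mathcal C)E(g\mid\mathcal C)$ for all bounded $\mathcal A$-measurable $f$ and $\mathcal B$-measurable $g$. *)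

theory Defs
  imports "HOL-Probability.Probability"
begin

text \<open>
  Many-sorted real-valued (continuous) logic. A predicate symbol takes values in a bounded real
  interval, connectives are arbitrary continuous functions, quantifiers are suprema and infima.
  Equality is available as a logical symbol, with values 0 and 1, on the sorts in
  \<open>eq_sorts\<close>. Classical first-order logic is the case where all predicates take the values
  0 and 1 and all sorts have equality; a metric structure is the case where \<open>eq_sorts\<close> is
  empty and the metrics are among the predicate symbols.
\<close>

record ('s, 'f, 'p) language =
  fun_args :: "'f \<Rightarrow> 's list"
  fun_res :: "'f \<Rightarrow> 's"
  pred_args :: "'p \<Rightarrow> 's list"
  pred_bound :: "'p \<Rightarrow> real"
  eq_sorts :: "'s set"

definition countable_language :: "('s, 'f, 'p) language \<Rightarrow> bool" where
  "countable_language L \<longleftrightarrow>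
     countable (UNIV :: 's set) \<and> countable (UNIV :: 'f set) \<and> countable (UNIV :: 'p set)"

text \<open>
  \<open>Par s a\<close> is the constant symbol naming the element \<open>a\<close> of sort \<open>s\<close>; the formulas of
  the language itself are those without such parameters.
\<close>

datatype ('s, 'f, 'a) tm =
    Var 's nat
  | Par 's 'a
  | Fn 'f "('s, 'f, 'a) tm list"

datatype ('s, 'f, 'p, 'a) fm =
    Const real
  | Equal "('s, 'f, 'a) tm" "('s, 'f, 'a) tm"
  | Pred 'p "('s, 'f, 'a) tm list"
  | Conn "real \<Rightarrow> real \<Rightarrow> real" "('s, 'f, 'p, 'a) fm" "('s, 'f, 'p, 'a) fm"
  | SupQ 's nat "('s, 'f, 'p, 'a) fm"
  | InfQ 's nat "('s, 'f, 'p, 'a) fm"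

fun tm_sort :: "('s, 'f, 'p) language \<Rightarrow> ('s, 'f, 'a) tm \<Rightarrow> 's" where
  "tm_sort L (Var s i) = s"
| "tm_sort L (Par s a) = s"
| "tm_sort L (Fn f ts) = fun_res L f"

fun wf_tm :: "('s, 'f, 'p) language \<Rightarrow> ('s, 'f, 'a) tm \<Rightarrow> bool" where
  "wf_tm L (Var s i) \<longleftrightarrow> True"
| "wf_tm L (Par s a) \<longleftrightarrow> True"
| "wf_tm L (Fn f ts) \<longleftrightarrow> (\<forall>t\<in>set ts. wf_tm L t) \<and> map (tm_sort L) ts = fun_args L f"

fun tm_vars :: "('s, 'f, 'a) tm \<Rightarrow> ('s \<times> nat) set" where
  "tm_vars (Var s i) = {(s, i)}"
| "tm_vars (Par s a) = {}"
| "tm_vars (Fn f ts) = (\<Union>t\<in>set ts. tm_vars t)"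

fun tm_pars :: "('s, 'f, 'a) tm \<Rightarrow> ('s \<times> 'a) set" where
  "tm_pars (Var s i) = {}"
| "tm_pars (Par s a) = {(s, a)}"
| "tm_pars (Fn f ts) = (\<Union>t\<in>set ts. tm_pars t)"

fun wf_fm :: "('s, 'f, 'p) language \<Rightarrow> ('s, 'f, 'p, 'a) fm \<Rightarrow> bool" where
  "wf_fm L (Const r) \<longleftrightarrow> True"
| "wf_fm L (Equal t t') \<longleftrightarrow>
     wf_tm L t \<and> wf_tm L t' \<and> tm_sort L t = tm_sort L t' \<and> tm_sort L t \<in> eq_sorts L"
| "wf_fm L (Pred R ts) \<longleftrightarrow> (\<forall>t\<in>set ts. wf_tm L t) \<and> map (tm_sort L) ts = pred_args L R"
| "wf_fm L (Conn c \<phi> \<psi>) \<longleftrightarrow>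
     continuous_on UNIV (\<lambda>(x, y). c x y) \<and> wf_fm L \<phi> \<and> wf_fm L \<psi>"
| "wf_fm L (SupQ s i \<phi>) \<longleftrightarrow> wf_fm L \<phi>"
| "wf_fm L (InfQ s i \<phi>) \<longleftrightarrow> wf_fm L \<phi>"

fun fm_fv :: "('s, 'f, 'p, 'a) fm \<Rightarrow> ('s \<times> nat) set" where
  "fm_fv (Const r) = {}"
| "fm_fv (Equal t t') = tm_vars t \<union> tm_vars t'"
| "fm_fv (Pred R ts) = (\<Union>t\<in>set ts. tm_vars t)"
| "fm_fv (Conn c \<phi> \<psi>) = fm_fv \<phi> \<union> fm_fv \<psi>"
| "fm_fv (SupQ s i \<phi>) = fm_fv \<phi> - {(s, i)}"
| "fm_fv (InfQ s i \<phi>) = fm_fv \<phi> - {(s, i)}"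

fun fm_pars :: "('s, 'f, 'p, 'a) fm \<Rightarrow> ('s \<times> 'a) set" where
  "fm_pars (Const r) = {}"
| "fm_pars (Equal t t') = tm_pars t \<union> tm_pars t'"
| "fm_pars (Pred R ts) = (\<Union>t\<in>set ts. tm_pars t)"
| "fm_pars (Conn c \<phi> \<psi>) = fm_pars \<phi> \<union> fm_pars \<psi>"
| "fm_pars (SupQ s i \<phi>) = fm_pars \<phi>"
| "fm_pars (InfQ s i \<phi>) = fm_pars \<phi>"

record ('s, 'f, 'p, 'a) struct =
  dom :: "'s \<Rightarrow> 'a set"
  fun_int :: "'f \<Rightarrow> 'a list \<Rightarrow> 'a"
  pred_int :: "'p \<Rightarrow> 'a list \<Rightarrow> real"

definition is_struct :: "('s, 'f, 'p) language \<Rightarrow> ('s, 'f, 'p, 'a) struct \<Rightarrow> bool" where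
  "is_struct L N \<longleftrightarrow>
     (\<forall>s. dom N s \<noteq> {}) \<and>
     (\<forall>f as. list_all2 (\<lambda>a s. a \<in> dom N s) as (fun_args L f)
        \<longrightarrow> fun_int N f as \<in> dom N (fun_res L f)) \<and>
     (\<forall>R as. list_all2 (\<lambda>a s. a \<in> dom N s) as (pred_args L R)
        \<longrightarrow> \<bar>pred_int N R as\<bar> \<le> pred_bound L R)"

definition valuations :: "('s, 'f, 'p, 'a) struct \<Rightarrow> ('s \<times> nat \<Rightarrow> 'a) set" where
  "valuations N = {\<alpha>. \<forall>s i. \<alpha> (s, i) \<in> dom N s}"

fun tm_val :: "('s, 'f, 'p, 'a) struct \<Rightarrow> ('s \<times> nat \<Rightarrow> 'a) \<Rightarrow> ('s, 'f, 'a) tm \<Rightarrow> 'a" where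
  "tm_val N \<alpha> (Var s i) = \<alpha> (s, i)"
| "tm_val N \<alpha> (Par s a) = a"
| "tm_val N \<alpha> (Fn f ts) = fun_int N f (map (tm_val N \<alpha>) ts)"

fun fm_val ::
  "('s, 'f, 'p, 'a) struct \<Rightarrow> ('s \<times> nat \<Rightarrow> 'a) \<Rightarrow> ('s, 'f, 'p, 'a) fm \<Rightarrow> real" where
  "fm_val N \<alpha> (Const r) = r"
| "fm_val N \<alpha> (Equal t t') = (if tm_val N \<alpha> t = tm_val N \<alpha> t' then 1 else 0)"
| "fm_val N \<alpha> (Pred R ts) = pred_int N R (map (tm_val N \<alpha>) ts)"
| "fm_val N \<alpha> (Conn c \<phi> \<psi>) = c (fm_val N \<alpha> \<phi>) (fm_val N \<alpha> \<psi>)"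
| "fm_val N \<alpha> (SupQ s i \<phi>) = (SUP a\<in>dom N s. fm_val N (\<alpha>((s, i) := a)) \<phi>)"
| "fm_val N \<alpha> (InfQ s i \<phi>) = (INF a\<in>dom N s. fm_val N (\<alpha>((s, i) := a)) \<phi>)"

definition L_formulas :: "('s, 'f, 'p) language \<Rightarrow> ('s, 'f, 'p, 'a) fm set" where
  "L_formulas L = {\<phi>. wf_fm L \<phi> \<and> fm_pars \<phi> = {}}"

definition L_sentences :: "('s, 'f, 'p) language \<Rightarrow> ('s, 'f, 'p, 'a) fm set" where
  "L_sentences L = {\<phi> \<in> L_formulas L. fm_fv \<phi> = {}}"

text \<open>
  A theory is a set of sentences \<open>\<sigma>\<close>, read as the conditions \<open>\<sigma> = 0\<close>. The value of a
  sentence does not depend on the valuation.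
\<close>

definition is_model ::
  "('s, 'f, 'p) language \<Rightarrow> ('s, 'f, 'p, 'a) fm set \<Rightarrow> ('s, 'f, 'p, 'a) struct \<Rightarrow> bool" where
  "is_model L T N \<longleftrightarrow>
     is_struct L N \<and> (\<forall>\<sigma>\<in>T. \<forall>\<alpha>\<in>valuations N. fm_val N \<alpha> \<sigma> = 0)"

definition complete_theory ::
  "('s, 'f, 'p) language \<Rightarrow> ('s, 'f, 'p, 'a) fm set \<Rightarrow> bool" where
  "complete_theory L T \<longleftrightarrow>
     T \<subseteq> L_sentences L \<and> (\<exists>N. is_model L T N) \<and>
     (\<forall>\<sigma>\<in>L_sentences L. \<exists>r. \<forall>N. is_model L T N \<longrightarrow> (\<forall>\<alpha>\<in>valuations N. fm_val N \<alpha> \<sigma> = r))"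

text \<open>
  The formulas over \<open>N\<close> in the variables \<open>x\<^sub>i\<close>, \<open>i \<in> u\<close>, of sort \<open>X\<close>; the variable
  \<open>x\<^sub>i\<close> is \<open>Var X i\<close>.
\<close>

definition formulas_over ::
  "('s, 'f, 'p) language \<Rightarrow> ('s, 'f, 'p, 'a) struct \<Rightarrow> 's \<Rightarrow> nat set
     \<Rightarrow> ('s, 'f, 'p, 'a) fm set" where
  "formulas_over L N X u =
     {\<phi>. wf_fm L \<phi> \<and> (\<forall>(s, a)\<in>fm_pars \<phi>. a \<in> dom N s) \<and> fm_fv \<phi> \<subseteq> {X} \<times> u}"

text \<open>
  The functions on \<open>X(N)\<close> definable with parameters from \<open>N\<close>, that is, the uniform limits of
  formulas over \<open>N\<close>. Uniform limits are needed because \<open>E\<^sub>x \<phi>(x, y)\<close> need not be a finitary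
  formula in \<open>y\<close>: for classical \<open>\<phi>\<close> it is a continuous function of the type of \<open>y\<close>.
\<close>

definition definable_functions ::
  "('s, 'f, 'p) language \<Rightarrow> ('s, 'f, 'p, 'a) struct \<Rightarrow> 's \<Rightarrow> ('a \<Rightarrow> real) set" where
  "definable_functions L N X =
     {h. \<forall>\<epsilon>>0. \<exists>i. \<exists>\<phi>\<in>formulas_over L N X {i}. \<forall>\<alpha>\<in>valuations N. \<forall>a\<in>dom N X.
           \<bar>h a - fm_val N (\<alpha>((X, i) := a)) \<phi>\<bar> \<le> \<epsilon>}"

text \<open>
  The expectation quantifier \<open>E\<^sub>x\<close>, interpreted in each model \<open>N\<close> of \<open>T\<close>: a normalized
  positive linear functional \<open>E N\<close> on the definable functions on \<open>X(N)\<close> such that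
  \<open>E\<^sub>x \<phi>(x, y)\<close> is, uniformly in the models of \<open>T\<close>, a parameter-free definable predicate
  in the remaining variables. Here and in the other definitions, models have universes in the
  type \<open>'a\<close>. This only relaxes the hypotheses: data given for all models of \<open>T\<close> restrict to
  the models in \<open>'a\<close>, and every model \<open>M\<close> has its universe in some type.
\<close>

definition definable_measure ::
  "('s, 'f, 'p) language \<Rightarrow> ('s, 'f, 'p, 'a) fm set \<Rightarrow> 's
     \<Rightarrow> (('s, 'f, 'p, 'a) struct \<Rightarrow> ('a \<Rightarrow> real) \<Rightarrow> real) \<Rightarrow> bool" where
  "definable_measure L T X E \<longleftrightarrow>
     (\<forall>N. is_model L T N \<longrightarrow>
        (\<forall>g h. (\<forall>a\<in>dom N X. g a = h a) \<longrightarrow> E N g = E N h) \<and>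
        (\<forall>g\<in>definable_functions L N X. \<forall>h\<in>definable_functions L N X. \<forall>c d.
           E N (\<lambda>a. c * g a + d * h a) = c * E N g + d * E N h) \<and>
        (\<forall>g\<in>definable_functions L N X. (\<forall>a\<in>dom N X. 0 \<le> g a) \<longrightarrow> 0 \<le> E N g) \<and>
        E N (\<lambda>a. 1) = 1) \<and>
     (\<forall>\<phi>\<in>L_formulas L. \<forall>i. \<forall>\<epsilon>>0. \<exists>\<psi>\<in>L_formulas L. fm_fv \<psi> \<subseteq> fm_fv \<phi> - {(X, i)} \<and>
        (\<forall>N. is_model L T N \<longrightarrow> (\<forall>\<alpha>\<in>valuations N.
           \<bar>E N (\<lambda>a. fm_val N (\<alpha>((X, i) := a)) \<phi>) - fm_val N \<alpha> \<psi>\<bar> \<le> \<epsilon>)))"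

fun iterated_expectation ::
  "'s \<Rightarrow> (('a \<Rightarrow> real) \<Rightarrow> real) \<Rightarrow> nat list \<Rightarrow> (('s \<times> nat \<Rightarrow> 'a) \<Rightarrow> real)
     \<Rightarrow> ('s \<times> nat \<Rightarrow> 'a) \<Rightarrow> real" where
  "iterated_expectation X e [] F \<alpha> = F \<alpha>"
| "iterated_expectation X e (i # is) F \<alpha> =
     e (\<lambda>a. iterated_expectation X e is F (\<alpha>((X, i) := a)))"

definition satisfies_fubini ::
  "('s, 'f, 'p) language \<Rightarrow> ('s, 'f, 'p, 'a) fm set \<Rightarrow> 's
     \<Rightarrow> (('s, 'f, 'p, 'a) struct \<Rightarrow> ('a \<Rightarrow> real) \<Rightarrow> real) \<Rightarrow> bool" where
  "satisfies_fubini L T X E \<longleftrightarrow>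
     (\<forall>N is js. is_model L T N \<longrightarrow> distinct is \<longrightarrow> distinct js \<longrightarrow> set is = set js \<longrightarrow>
        (\<forall>\<phi>\<in>formulas_over L N X (set is). \<forall>\<alpha>\<in>valuations N.
           iterated_expectation X (E N) is (\<lambda>\<beta>. fm_val N \<beta> \<phi>) \<alpha>
             = iterated_expectation X (E N) js (\<lambda>\<beta>. fm_val N \<beta> \<phi>) \<alpha>))"

text \<open>
  Complete types over \<open>N\<close> in the variables \<open>x\<^sub>i\<close>, \<open>i \<in> u\<close>: assignments of values to the
  formulas over \<open>N\<close> that are (approximately) finitely satisfiable in \<open>N\<close>.
\<close>

definition types ::
  "('s, 'f, 'p) language \<Rightarrow> ('s, 'f, 'p, 'a) struct \<Rightarrow> 's \<Rightarrow> nat set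
     \<Rightarrow> (('s, 'f, 'p, 'a) fm \<Rightarrow> real) set" where
  "types L N X u =
     {p \<in> extensional (formulas_over L N X u).
        \<forall>\<Phi>. finite \<Phi> \<longrightarrow> \<Phi> \<subseteq> formulas_over L N X u \<longrightarrow>
          (\<forall>\<epsilon>>0. \<exists>\<alpha>\<in>valuations N. \<forall>\<phi>\<in>\<Phi>. \<bar>p \<phi> - fm_val N \<alpha> \<phi>\<bar> < \<epsilon>)}"

text \<open>
  The sigma-algebra is generated by the formulas over \<open>N\<close> (the Baire sets of the compact space
  of types); for uncountable \<open>N\<close> it can be smaller than the Borel one.
\<close>

definition type_space ::
  "('s, 'f, 'p) language \<Rightarrow> ('s, 'f, 'p, 'a) struct \<Rightarrow> 's \<Rightarrow> nat set
     \<Rightarrow> (('s, 'f, 'p, 'a) fm \<Rightarrow> real) measure" where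
  "type_space L N X u =
     sigma (types L N X u)
       {{p \<in> types L N X u. p \<phi> \<le> r} | \<phi> r. \<phi> \<in> formulas_over L N X u}"

text \<open>
  The measure on the type space given by \<open>E\<^bsub>x\<^sub>1\<^esub> \<dots> E\<^bsub>x\<^sub>n\<^esub>\<close>; it exists and is unique by the Riesz
  representation theorem.
\<close>

definition induced_measure ::
  "('s, 'f, 'p) language \<Rightarrow> ('s, 'f, 'p, 'a) struct \<Rightarrow> 's \<Rightarrow> (('a \<Rightarrow> real) \<Rightarrow> real) \<Rightarrow> nat set
     \<Rightarrow> (('s, 'f, 'p, 'a) fm \<Rightarrow> real) measure \<Rightarrow> bool" where
  "induced_measure L N X e u P \<longleftrightarrow>
     prob_space P \<and> space P = types L N X u \<and> sets P = sets (type_space L N X u) \<and>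
     (\<forall>\<phi>\<in>formulas_over L N X u. \<forall>\<alpha>\<in>valuations N.
        (\<integral>p. p \<phi> \<partial>P)
          = iterated_expectation X e (sorted_list_of_set u) (\<lambda>\<beta>. fm_val N \<beta> \<phi>) \<alpha>)"

text \<open>
  \<open>L\<^sub>u(N)\<close> embedded in \<open>L\<^bsub>{1..n}\<^esub>(N)\<close>: the pullback under the projection from
  types in \<open>x\<^sub>1, \<dots>, x\<^sub>n\<close> to types in \<open>x\<^sub>i\<close>, \<open>i \<in> u\<close>.
\<close>

definition formula_algebra ::
  "('s, 'f, 'p) language \<Rightarrow> ('s, 'f, 'p, 'a) struct \<Rightarrow> 's \<Rightarrow> nat \<Rightarrow> nat set
     \<Rightarrow> (('s, 'f, 'p, 'a) fm \<Rightarrow> real) measure" where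
  "formula_algebra L N X n u =
     vimage_algebra (types L N X {1..n}) (\<lambda>p. restrict p (formulas_over L N X u))
       (type_space L N X u)"

definition independent_over :: "'b measure \<Rightarrow> 'b measure \<Rightarrow> 'b measure \<Rightarrow> 'b measure \<Rightarrow> bool" where
  "independent_over P A B C \<longleftrightarrow>
     subalgebra P A \<and> subalgebra P B \<and> subalgebra P C \<and>
     (\<forall>f g :: 'b \<Rightarrow> real. f \<in> borel_measurable A \<longrightarrow> g \<in> borel_measurable B \<longrightarrow>
        bounded (f ` space P) \<longrightarrow> bounded (g ` space P) \<longrightarrow>
        (AE p in P. real_cond_exp P C (\<lambda>q. f q * g q) p
           = real_cond_exp P C f p * real_cond_exp P C g p))"

definition generated_algebra :: "'b measure \<Rightarrow> 'b measure set \<Rightarrow> 'b measure" where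
  "generated_algebra P \<A> = sigma (space P) (\<Union>A\<in>\<A>. sets A)"

definition independent_system :: "'b measure \<Rightarrow> nat \<Rightarrow> (nat set \<Rightarrow> 'b measure) \<Rightarrow> bool" where
  "independent_system P n A \<longleftrightarrow>
     (\<forall>u. u \<subseteq> {1..n} \<longrightarrow>
        independent_over P (A u)
          (generated_algebra P {A v | v. v \<subseteq> {1..n} \<and> \<not> u \<subseteq> v})
          (generated_algebra P {A w | w. w \<subset> u}))"

end

theory Submission
  imports Defs
begin

text \<open>
  Let \<open>f\<close> be measurable over \<open>L\<^sub>u\<close>, let \<open>\<C>\<close> be generated by the \<open>L\<^sub>w\<close>, \<open>w \<subset> u\<close>, and let \<open>g\<close> be a formula
  built from formulas in \<open>L\<^sub>v\<close> with \<open>u \<not>\<subseteq> v\<close>. Substituting elements of \<open>M\<close> for the variables outside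
  \<open>u\<close> turns a formula of \<open>L\<^sub>v\<close> into one of \<open>L\<^bsub>v \<inter> u\<^esub>\<close>, hence \<open>g\<close> into a \<open>\<C>\<close>-measurable function,
  which is orthogonal to \<open>f - E(f | \<C>)\<close>. By Fubini the variables outside \<open>u\<close> may be integrated last,
  where they range over \<open>M\<close> only; since the expectation quantifiers are positive on the definable
  functions of \<open>M\<close>, a bound that is uniform in the substituted elements survives this integration.
  Thus \<open>f - E(f | \<C>)\<close>, approximated in \<open>L\<^sup>1\<close> by formulas over \<open>M\<close>, is orthogonal to \<open>g\<close>. As formulas are
  dense in \<open>L\<^sup>1\<close>, the conditional expectation of \<open>f\<close> over all the \<open>L\<^sub>v\<close> with \<open>u \<not>\<subseteq> v\<close> is \<open>E(f | \<C>)\<close>,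
  which is independence.
\<close>

section \<open>Substitution and abstraction of parameters\<close>

fun tm_inst ::
  "('s \<times> nat) set \<Rightarrow> ('s \<times> nat \<Rightarrow> 'a) \<Rightarrow> ('s, 'f, 'a) tm \<Rightarrow> ('s, 'f, 'a) tm" where
  "tm_inst V \<alpha> (Var s i) = (if (s, i) \<in> V then Par s (\<alpha> (s, i)) else Var s i)"
| "tm_inst V \<alpha> (Par s a) = Par s a"
| "tm_inst V \<alpha> (Fn f ts) = Fn f (map (tm_inst V \<alpha>) ts)"

text \<open>A quantifier removes its variable from V, so only free occurrences are replaced.
  Parameters contain no variables, hence no capture can occur. V may be infinite: later it is the
  complement of a finite set of variables.\<close>

fun fm_inst ::
  "('s \<times> nat) set \<Rightarrow> ('s \<times> nat \<Rightarrow> 'a) \<Rightarrow> ('s, 'f, 'p, 'a) fm \<Rightarrow> ('s, 'f, 'p, 'a) fm" where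
  "fm_inst V \<alpha> (Const r) = Const r"
| "fm_inst V \<alpha> (Equal t t') = Equal (tm_inst V \<alpha> t) (tm_inst V \<alpha> t')"
| "fm_inst V \<alpha> (Pred R ts) = Pred R (map (tm_inst V \<alpha>) ts)"
| "fm_inst V \<alpha> (Conn c \<phi> \<psi>) = Conn c (fm_inst V \<alpha> \<phi>) (fm_inst V \<alpha> \<psi>)"
| "fm_inst V \<alpha> (SupQ s i \<phi>) = SupQ s i (fm_inst (V - {(s, i)}) \<alpha> \<phi>)"
| "fm_inst V \<alpha> (InfQ s i \<phi>) = InfQ s i (fm_inst (V - {(s, i)}) \<alpha> \<phi>)"

lemma tm_sort_inst [simp]: "tm_sort L (tm_inst V \<alpha> t) = tm_sort L t"
  by (cases t) auto

lemma wf_tm_inst: "wf_tm L t \<Longrightarrow> wf_tm L (tm_inst V \<alpha> t)"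
proof (induction t)
  case (Fn f ts)
  have "map (tm_sort L) (map (tm_inst V \<alpha>) ts) = map (tm_sort L) ts" by simp
  with Fn show ?case by auto
qed auto

lemma tm_vars_inst: "tm_vars (tm_inst V \<alpha> t) = tm_vars t - V"
  by (induction t) auto

lemma tm_pars_inst: "tm_pars (tm_inst V \<alpha> t) \<subseteq> tm_pars t \<union> {(s, \<alpha> (s, i)) | s i. True}"
proof (induction t)
  case (Fn f ts)
  then show ?case by (simp, blast)
qed auto

lemma tm_val_inst: "tm_val N \<beta> (tm_inst V \<alpha> t) = tm_val N (override_on \<beta> \<alpha> V) t"
proof (induction t)
  case (Fn f ts)
  then have "map (tm_val N \<beta> \<circ> tm_inst V \<alpha>) ts = map (tm_val N (override_on \<beta> \<alpha> V)) ts" by simp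
  then show ?case by (simp del: map_eq_conv)
qed (auto simp: override_on_def)

lemma wf_fm_inst: "wf_fm L \<phi> \<Longrightarrow> wf_fm L (fm_inst V \<alpha> \<phi>)"
proof (induction \<phi> arbitrary: V)
  case (Pred R ts)
  have "map (tm_sort L) (map (tm_inst V \<alpha>) ts) = map (tm_sort L) ts" by simp
  with Pred show ?case by (auto simp: wf_tm_inst)
qed (auto simp: wf_tm_inst)

lemma fm_fv_inst: "fm_fv (fm_inst V \<alpha> \<phi>) = fm_fv \<phi> - V"
  by (induction \<phi> arbitrary: V) (auto simp: tm_vars_inst)

lemma fm_pars_inst: "fm_pars (fm_inst V \<alpha> \<phi>) \<subseteq> fm_pars \<phi> \<union> {(s, \<alpha> (s, i)) | s i. True}"
proof (induction \<phi> arbitrary: V)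
  case (Equal t t')
  then show ?case using tm_pars_inst[of V \<alpha> t] tm_pars_inst[of V \<alpha> t'] by auto
next
  case (Pred R ts)
  then show ?case using tm_pars_inst[of V \<alpha>] by fastforce
qed (simp_all, blast+)

text \<open>The quantifier case of \<open>fm_val_inst\<close>: once the bound variable has left V,
  updating it and overriding by \<open>\<alpha>\<close> commute.\<close>

lemma override_on_upd:
  "override_on (\<beta>(v := a)) \<alpha> (V - {v}) = (override_on \<beta> \<alpha> V)(v := a)"
  by (auto simp: override_on_def)

lemma fm_val_inst: "fm_val N \<beta> (fm_inst V \<alpha> \<phi>) = fm_val N (override_on \<beta> \<alpha> V) \<phi>"
proof (induction \<phi> arbitrary: V \<beta>)
  case (Pred R ts)
  have "map (tm_val N \<beta> \<circ> tm_inst V \<alpha>) ts = map (tm_val N (override_on \<beta> \<alpha> V)) ts"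
    by (simp add: tm_val_inst)
  then show ?case by (simp del: map_eq_conv)
qed (simp_all add: tm_val_inst override_on_upd)

lemma tm_inst_ident: "tm_vars t \<inter> V = {} \<Longrightarrow> tm_inst V \<alpha> t = t"
proof (induction t)
  case (Fn f ts)
  then show ?case by (auto intro!: map_idI)
qed auto

lemma fm_inst_ident: "fm_fv \<phi> \<inter> V = {} \<Longrightarrow> fm_inst V \<alpha> \<phi> = \<phi>"
proof (induction \<phi> arbitrary: V)
  case (Pred R ts)
  then show ?case by (auto intro!: map_idI tm_inst_ident)
next
  case (Conn c \<phi> \<psi>)
  then show ?case by (simp add: Int_Un_distrib2)
next
  case (SupQ s i \<phi>)
  have "fm_inst (V - {(s, i)}) \<alpha> \<phi> = \<phi>" by (rule SupQ.IH) (use SupQ.prems in auto)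
  then show ?case by simp
next
  case (InfQ s i \<phi>)
  have "fm_inst (V - {(s, i)}) \<alpha> \<phi> = \<phi>" by (rule InfQ.IH) (use InfQ.prems in auto)
  then show ?case by simp
qed (simp_all add: tm_inst_ident Int_Un_distrib2)

section \<open>Replacing parameters by variables\<close>

fun tm_abs :: "('s \<times> 'a \<Rightarrow> nat) \<Rightarrow> ('s, 'f, 'a) tm \<Rightarrow> ('s, 'f, 'a) tm" where
  "tm_abs \<rho> (Var s i) = Var s i"
| "tm_abs \<rho> (Par s a) = Var s (\<rho> (s, a))"
| "tm_abs \<rho> (Fn f ts) = Fn f (map (tm_abs \<rho>) ts)"

fun fm_abs :: "('s \<times> 'a \<Rightarrow> nat) \<Rightarrow> ('s, 'f, 'p, 'a) fm \<Rightarrow> ('s, 'f, 'p, 'a) fm" where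
  "fm_abs \<rho> (Const r) = Const r"
| "fm_abs \<rho> (Equal t t') = Equal (tm_abs \<rho> t) (tm_abs \<rho> t')"
| "fm_abs \<rho> (Pred R ts) = Pred R (map (tm_abs \<rho>) ts)"
| "fm_abs \<rho> (Conn c \<phi> \<psi>) = Conn c (fm_abs \<rho> \<phi>) (fm_abs \<rho> \<psi>)"
| "fm_abs \<rho> (SupQ s i \<phi>) = SupQ s i (fm_abs \<rho> \<phi>)"
| "fm_abs \<rho> (InfQ s i \<phi>) = InfQ s i (fm_abs \<rho> \<phi>)"

fun fm_bv :: "('s, 'f, 'p, 'a) fm \<Rightarrow> ('s \<times> nat) set" where
  "fm_bv (Const r) = {}"
| "fm_bv (Equal t t') = {}"
| "fm_bv (Pred R ts) = {}"
| "fm_bv (Conn c \<phi> \<psi>) = fm_bv \<phi> \<union> fm_bv \<psi>"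
| "fm_bv (SupQ s i \<phi>) = insert (s, i) (fm_bv \<phi>)"
| "fm_bv (InfQ s i \<phi>) = insert (s, i) (fm_bv \<phi>)"

lemma finite_tm_vars: "finite (tm_vars t)"
  by (induction t) auto

lemma finite_tm_pars: "finite (tm_pars t)"
  by (induction t) auto

lemma finite_fm_fv: "finite (fm_fv \<phi>)"
  by (induction \<phi>) (auto simp: finite_tm_vars)

lemma finite_fm_pars: "finite (fm_pars \<phi>)"
  by (induction \<phi>) (auto simp: finite_tm_pars)

lemma finite_fm_bv: "finite (fm_bv \<phi>)"
  by (induction \<phi>) auto

lemma tm_sort_abs [simp]: "tm_sort L (tm_abs \<rho> t) = tm_sort L t"
  by (cases t) auto

lemma wf_tm_abs: "wf_tm L t \<Longrightarrow> wf_tm L (tm_abs \<rho> t)"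
proof (induction t)
  case (Fn f ts)
  have "map (tm_sort L) (map (tm_abs \<rho>) ts) = map (tm_sort L) ts" by simp
  with Fn show ?case by auto
qed auto

lemma wf_fm_abs: "wf_fm L \<phi> \<Longrightarrow> wf_fm L (fm_abs \<rho> \<phi>)"
proof (induction \<phi>)
  case (Pred R ts)
  have "map (tm_sort L) (map (tm_abs \<rho>) ts) = map (tm_sort L) ts" by simp
  with Pred show ?case by (auto simp: wf_tm_abs)
qed (auto simp: wf_tm_abs)

lemma tm_pars_abs: "tm_pars (tm_abs \<rho> t) = {}"
  by (induction t) auto

lemma fm_pars_abs: "fm_pars (fm_abs \<rho> \<phi>) = {}"
  by (induction \<phi>) (auto simp: tm_pars_abs)

lemma tm_val_abs:
  assumes "\<And>s a. (s, a) \<in> tm_pars t \<Longrightarrow> \<gamma> (s, \<rho> (s, a)) = a"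
  shows "tm_val N \<gamma> (tm_abs \<rho> t) = tm_val N \<gamma> t"
  using assms
proof (induction t)
  case (Fn f ts)
  have "\<And>t. t \<in> set ts \<Longrightarrow> tm_val N \<gamma> (tm_abs \<rho> t) = tm_val N \<gamma> t"
    using Fn by auto
  then have "map (tm_val N \<gamma> \<circ> tm_abs \<rho>) ts = map (tm_val N \<gamma>) ts" by simp
  then show ?case by (simp del: map_eq_conv)
qed auto

text \<open>\<open>fm_abs\<close> does nothing to avoid capture. The second condition keeps the
  variables that name parameters out of the range of all quantifiers, so the updates made by
  quantifiers leave their values alone and the hypothesis survives into the body.\<close>

lemma fm_val_abs:
  assumes "\<And>s a. (s, a) \<in> fm_pars \<phi> \<Longrightarrow> \<gamma> (s, \<rho> (s, a)) = a \<and> (s, \<rho> (s, a)) \<notin> fm_bv \<phi>"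
  shows "fm_val N \<gamma> (fm_abs \<rho> \<phi>) = fm_val N \<gamma> \<phi>"
  using assms
proof (induction \<phi> arbitrary: \<gamma>)
  case (Pred R ts)
  have "\<And>t. t \<in> set ts \<Longrightarrow> tm_val N \<gamma> (tm_abs \<rho> t) = tm_val N \<gamma> t"
    using Pred by (intro tm_val_abs) auto
  then have "map (tm_val N \<gamma> \<circ> tm_abs \<rho>) ts = map (tm_val N \<gamma>) ts" by simp
  then show ?case by (simp del: map_eq_conv)
next
  case (Equal t t')
  have "tm_val N \<gamma> (tm_abs \<rho> t) = tm_val N \<gamma> t" "tm_val N \<gamma> (tm_abs \<rho> t') = tm_val N \<gamma> t'"
    using Equal by (auto intro!: tm_val_abs)
  then show ?case by simp
next
  case (Conn c \<phi> \<psi>)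
  have "fm_val N \<gamma> (fm_abs \<rho> \<phi>) = fm_val N \<gamma> \<phi>" "fm_val N \<gamma> (fm_abs \<rho> \<psi>) = fm_val N \<gamma> \<psi>"
    using Conn.prems by (auto intro!: Conn.IH)
  then show ?case by simp
next
  case (SupQ s i \<phi>)
  have "fm_val N (\<gamma>((s, i) := a)) (fm_abs \<rho> \<phi>) = fm_val N (\<gamma>((s, i) := a)) \<phi>" for a
    using SupQ.prems by (intro SupQ.IH) auto
  then show ?case by simp
next
  case (InfQ s i \<phi>)
  have "fm_val N (\<gamma>((s, i) := a)) (fm_abs \<rho> \<phi>) = fm_val N (\<gamma>((s, i) := a)) \<phi>" for a
    using InfQ.prems by (intro InfQ.IH) auto
  then show ?case by simp
qed auto

section \<open>Dependence on free variables; elimination of parameters\<close>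

lemma tm_val_cong:
  assumes "\<And>v. v \<in> tm_vars t \<Longrightarrow> \<alpha> v = \<beta> v"
  shows "tm_val N \<alpha> t = tm_val N \<beta> t"
  using assms
proof (induction t)
  case (Fn f ts)
  have "map (tm_val N \<alpha>) ts = map (tm_val N \<beta>) ts" using Fn by auto
  then show ?case by (simp del: map_eq_conv)
qed auto

lemma fm_val_cong:
  assumes "\<And>v. v \<in> fm_fv \<phi> \<Longrightarrow> \<alpha> v = \<beta> v"
  shows "fm_val N \<alpha> \<phi> = fm_val N \<beta> \<phi>"
  using assms
proof (induction \<phi> arbitrary: \<alpha> \<beta>)
  case (Equal t t')
  have "tm_val N \<alpha> t = tm_val N \<beta> t" "tm_val N \<alpha> t' = tm_val N \<beta> t'"
    using Equal by (auto intro!: tm_val_cong)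
  then show ?case by simp
next
  case (Pred R ts)
  have "map (tm_val N \<alpha>) ts = map (tm_val N \<beta>) ts"
    using Pred by (auto intro!: tm_val_cong)
  then show ?case by (simp del: map_eq_conv)
next
  case (Conn c \<phi> \<psi>)
  have "fm_val N \<alpha> \<phi> = fm_val N \<beta> \<phi>" "fm_val N \<alpha> \<psi> = fm_val N \<beta> \<psi>"
    using Conn.prems by (auto intro!: Conn.IH)
  then show ?case by simp
next
  case (SupQ s i \<phi>)
  have "fm_val N (\<alpha>((s, i) := a)) \<phi> = fm_val N (\<beta>((s, i) := a)) \<phi>" for a
    using SupQ.prems by (intro SupQ.IH) auto
  then show ?case by simp
next
  case (InfQ s i \<phi>)
  have "fm_val N (\<alpha>((s, i) := a)) \<phi> = fm_val N (\<beta>((s, i) := a)) \<phi>" for a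
    using InfQ.prems by (intro InfQ.IH) auto
  then show ?case by simp
qed auto

lemma valuations_upd: "\<alpha> \<in> valuations N \<Longrightarrow> a \<in> dom N s \<Longrightarrow> \<alpha>((s, i) := a) \<in> valuations N"
  by (auto simp: valuations_def)

lemma valuations_override:
  "\<alpha> \<in> valuations N \<Longrightarrow> \<beta> \<in> valuations N \<Longrightarrow> override_on \<alpha> \<beta> V \<in> valuations N"
  by (auto simp: valuations_def override_on_def)

lemma valuations_nonempty: "is_struct L N \<Longrightarrow> valuations N \<noteq> {}"
proof -
  assume "is_struct L N"
  then have "\<forall>s. \<exists>a. a \<in> dom N s" by (auto simp: is_struct_def)
  then obtain d where "\<forall>s. d s \<in> dom N s" by metis
  then have "(\<lambda>(s, i). d s) \<in> valuations N" by (auto simp: valuations_def)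
  then show ?thesis by blast
qed

text \<open>Free variables are unrestricted here: a formula approximating an expectation may contain
  further variables, which are instantiated only afterwards.\<close>

definition formulas_with_params ::
  "('s, 'f, 'p) language \<Rightarrow> ('s, 'f, 'p, 'a) struct \<Rightarrow> ('s, 'f, 'p, 'a) fm set" where
  "formulas_with_params L N = {\<phi>. wf_fm L \<phi> \<and> (\<forall>(s, a)\<in>fm_pars \<phi>. a \<in> dom N s)}"

lemma formulas_over_iff:
  "\<phi> \<in> formulas_over L N X u \<longleftrightarrow> \<phi> \<in> formulas_with_params L N \<and> fm_fv \<phi> \<subseteq> {X} \<times> u"
  by (auto simp: formulas_over_def formulas_with_params_def)

lemma L_formulas_with_params: "\<phi> \<in> L_formulas L \<Longrightarrow> \<phi> \<in> formulas_with_params L N"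
  by (auto simp: L_formulas_def formulas_with_params_def)

lemma fm_inst_with_params:
  assumes "\<phi> \<in> formulas_with_params L N" "\<alpha> \<in> valuations N"
  shows "fm_inst V \<alpha> \<phi> \<in> formulas_with_params L N"
proof -
  have "a \<in> dom N s" if "(s, a) \<in> fm_pars (fm_inst V \<alpha> \<phi>)" for s a
    using subsetD[OF fm_pars_inst that] assms by (auto simp: formulas_with_params_def valuations_def)
  then show ?thesis
    using assms(1) by (auto simp: formulas_with_params_def wf_fm_inst)
qed

text \<open>The expectation quantifier is known to be definable on parameter-free formulas. This
  lemma carries that over to formulas over N: the parameters become new variables V, away from a
  prescribed finite set W, and \<open>\<kappa>\<close> puts the parameters back.\<close>

lemma parameter_abstraction:
  assumes str: "is_struct L N" and \<phi>: "\<phi> \<in> formulas_with_params L N" and W: "finite W"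
  obtains \<phi>' V \<kappa> where "\<phi>' \<in> L_formulas L" "V \<inter> W = {}" "\<kappa> \<in> valuations N"
    "\<And>\<alpha>. fm_val N \<alpha> \<phi> = fm_val N (override_on \<alpha> \<kappa> V) \<phi>'"
proof -
  define Q where "Q = fm_pars \<phi>"
  \<comment> \<open>Besides W, the new variables must avoid the free variables of
    \<open>\<phi>\<close>, whose values the override must not change, and its bound variables, which
    would capture them.\<close>
  define W' where "W' = W \<union> fm_fv \<phi> \<union> fm_bv \<phi>"
  have "finite (snd ` W')" using W by (simp add: W'_def finite_fm_fv finite_fm_bv)
  then obtain m where m: "\<And>j. j \<in> snd ` W' \<Longrightarrow> j < m"
    unfolding finite_nat_set_iff_bounded by blast
  have "finite Q" by (simp add: Q_def finite_fm_pars)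
  then obtain f :: "_ \<Rightarrow> nat" where f: "inj_on f Q"
    using finite_imp_inj_to_nat_seg by blast
  \<comment> \<open>Indices from m on exceed all indices in W', and injectivity of f gives distinct
    parameters distinct variables.\<close>
  define \<rho> where "\<rho> q = m + f q" for q
  define V where "V = (\<lambda>(s, a). (s, \<rho> (s, a))) ` Q"
  obtain \<alpha>0 where \<alpha>0: "\<alpha>0 \<in> valuations N" using valuations_nonempty[OF str] by blast
  \<comment> \<open>On V this inverts \<open>\<rho>\<close>, with uniqueness from injectivity.
    Elsewhere \<open>\<alpha>0\<close> is a default that makes \<open>\<kappa>\<close> a
    valuation.\<close>
  define \<kappa> where "\<kappa> = (\<lambda>(s, j). if (s, j) \<in> V then (THE a. (s, a) \<in> Q \<and> \<rho> (s, a) = j) else \<alpha>0 (s, j))"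
  have V_W: "V \<inter> W' = {}"
  proof -
    have "(s, \<rho> (s, a)) \<notin> W'" for s a
      using m[of "\<rho> (s, a)"] image_eqI[of "\<rho> (s, a)" snd "(s, \<rho> (s, a))" W']
      by (auto simp: \<rho>_def)
    then show ?thesis by (auto simp: V_def)
  qed
  have \<kappa>_par: "\<kappa> (s, \<rho> (s, a)) = a" if "(s, a) \<in> Q" for s a
  proof -
    have "(THE b. (s, b) \<in> Q \<and> \<rho> (s, b) = \<rho> (s, a)) = a"
      using that f by (intro the_equality) (auto simp: \<rho>_def inj_on_def)
    then show ?thesis using that by (force simp: \<kappa>_def V_def)
  qed
  have "\<kappa> (s, j) \<in> dom N s" for s j
  proof (cases "(s, j) \<in> V")
    case True
    then obtain a where a: "(s, a) \<in> Q" "j = \<rho> (s, a)" by (auto simp: V_def)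
    then show ?thesis using \<kappa>_par \<phi> by (auto simp: Q_def formulas_with_params_def)
  next
    case False
    then show ?thesis using \<alpha>0 by (auto simp: \<kappa>_def valuations_def)
  qed
  then have \<kappa>: "\<kappa> \<in> valuations N" by (auto simp: valuations_def)
  have eq: "fm_val N \<alpha> \<phi> = fm_val N (override_on \<alpha> \<kappa> V) (fm_abs \<rho> \<phi>)" for \<alpha>
  proof -
    have "fm_val N (override_on \<alpha> \<kappa> V) (fm_abs \<rho> \<phi>) = fm_val N (override_on \<alpha> \<kappa> V) \<phi>"
    proof (rule fm_val_abs)
      fix s a assume "(s, a) \<in> fm_pars \<phi>"
      then have "(s, a) \<in> Q" "(s, \<rho> (s, a)) \<in> V" by (auto simp: Q_def V_def)
      then show "override_on \<alpha> \<kappa> V (s, \<rho> (s, a)) = a \<and> (s, \<rho> (s, a)) \<notin> fm_bv \<phi>"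
        using V_W \<kappa>_par by (auto simp: W'_def)
    qed
    also have "\<dots> = fm_val N \<alpha> \<phi>"
      using V_W by (intro fm_val_cong) (auto simp: W'_def override_on_def)
    finally show ?thesis ..
  qed
  show ?thesis
  proof (rule that[OF _ _ \<kappa> eq])
    show "fm_abs \<rho> \<phi> \<in> L_formulas L"
      using \<phi> by (auto simp: L_formulas_def formulas_with_params_def wf_fm_abs fm_pars_abs)
    show "V \<inter> W = {}" using V_W by (auto simp: W'_def)
  qed
qed

section \<open>Uniform bounds for formulas\<close>

lemma tm_val_dom:
  assumes "is_struct L N" "\<alpha> \<in> valuations N" "wf_tm L t" "\<forall>(s, a)\<in>tm_pars t. a \<in> dom N s"
  shows "tm_val N \<alpha> t \<in> dom N (tm_sort L t)"
  using assms(3,4)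
proof (induction t)
  case (Var s i)
  then show ?case using assms(2) by (auto simp: valuations_def)
next
  case (Fn f ts)
  have "\<forall>t\<in>set ts. tm_val N \<alpha> t \<in> dom N (tm_sort L t)"
    using Fn by auto
  then have "list_all2 (\<lambda>a s. a \<in> dom N s) (map (tm_val N \<alpha>) ts) (map (tm_sort L) ts)"
    by (simp add: list_all2_map1 list_all2_map2 list_all2_same)
  then show ?case using Fn.prems assms(1) by (auto simp: is_struct_def)
qed auto

lemma bounded_fm_val:
  assumes str: "is_struct L N" and \<phi>: "\<phi> \<in> formulas_with_params L N"
  shows "\<exists>B. \<forall>\<alpha>\<in>valuations N. \<bar>fm_val N \<alpha> \<phi>\<bar> \<le> B"
  using \<phi>
proof (induction \<phi>)
  case (Const r)
  then show ?case by auto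
next
  case (Equal t t')
  then show ?case by (auto intro!: exI[of _ 1])
next
  case (Pred R ts)
  have "\<bar>fm_val N \<alpha> (Pred R ts)\<bar> \<le> pred_bound L R" if "\<alpha> \<in> valuations N" for \<alpha>
  proof -
    have "\<forall>t\<in>set ts. tm_val N \<alpha> t \<in> dom N (tm_sort L t)"
      using Pred by (auto simp: formulas_with_params_def intro!: tm_val_dom[OF str that])
    then have "list_all2 (\<lambda>a s. a \<in> dom N s) (map (tm_val N \<alpha>) ts) (map (tm_sort L) ts)"
      by (simp add: list_all2_map1 list_all2_map2 list_all2_same)
    then show ?thesis using Pred str by (auto simp: is_struct_def formulas_with_params_def)
  qed
  then show ?case by blast
next
  case (Conn c \<phi> \<psi>)
  then obtain B1 B2 where B: "\<And>\<alpha>. \<alpha> \<in> valuations N \<Longrightarrow> \<bar>fm_val N \<alpha> \<phi>\<bar> \<le> B1"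
    "\<And>\<alpha>. \<alpha> \<in> valuations N \<Longrightarrow> \<bar>fm_val N \<alpha> \<psi>\<bar> \<le> B2"
    by (fastforce simp: formulas_with_params_def)
  \<comment> \<open>A continuous connective may be unbounded on the plane, but here its arguments
    stay in a compact box.\<close>
  have "continuous_on ({-B1..B1} \<times> {-B2..B2}) (\<lambda>(x, y). c x y)"
    using Conn.prems by (auto simp: formulas_with_params_def intro: continuous_on_subset)
  then have "compact ((\<lambda>(x, y). c x y) ` ({-B1..B1} \<times> {-B2..B2}))"
    by (intro compact_continuous_image compact_Times) auto
  then have "bounded ((\<lambda>(x, y). c x y) ` ({-B1..B1} \<times> {-B2..B2}))"
    by (rule compact_imp_bounded)
  then obtain B where "\<forall>z\<in>(\<lambda>(x, y). c x y) ` ({-B1..B1} \<times> {-B2..B2}). norm z \<le> B"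
    unfolding bounded_iff by blast
  then have "\<bar>c x y\<bar> \<le> B" if "\<bar>x\<bar> \<le> B1" "\<bar>y\<bar> \<le> B2" for x y
    using that by (auto simp: abs_le_iff)
  then have "\<forall>\<alpha>\<in>valuations N. \<bar>fm_val N \<alpha> (Conn c \<phi> \<psi>)\<bar> \<le> B" using B by auto
  then show ?case ..
next
  case (SupQ s i \<phi>)
  then obtain B where B: "\<And>\<alpha>. \<alpha> \<in> valuations N \<Longrightarrow> \<bar>fm_val N \<alpha> \<phi>\<bar> \<le> B"
    by (fastforce simp: formulas_with_params_def)
  have "\<bar>fm_val N \<alpha> (SupQ s i \<phi>)\<bar> \<le> B" if "\<alpha> \<in> valuations N" for \<alpha>
    using str B valuations_upd[OF that] by (auto simp: is_struct_def intro!: cSup_abs_le)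
  then show ?case by blast
next
  case (InfQ s i \<phi>)
  then obtain B where B: "\<And>\<alpha>. \<alpha> \<in> valuations N \<Longrightarrow> \<bar>fm_val N \<alpha> \<phi>\<bar> \<le> B"
    by (fastforce simp: formulas_with_params_def)
  have "\<bar>fm_val N \<alpha> (InfQ s i \<phi>)\<bar> \<le> B" if "\<alpha> \<in> valuations N" for \<alpha>
    using str B valuations_upd[OF that] by (auto simp: is_struct_def intro!: cInf_abs_ge)
  then show ?case by blast
qed

section \<open>Iterated expectations\<close>

text \<open>The axioms of \<open>definable_measure\<close> read in one fixed model, with e for the
  functional on that model.\<close>

locale expectation =
  fixes L :: "('s, 'f, 'p) language"
    and N :: "('s, 'f, 'p, 'a) struct"
    and X :: 's
    and e :: "('a \<Rightarrow> real) \<Rightarrow> real"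
  assumes str: "is_struct L N"
    and cong: "\<And>g h. (\<And>a. a \<in> dom N X \<Longrightarrow> g a = h a) \<Longrightarrow> e g = e h"
    and linear: "\<And>g h c d. g \<in> definable_functions L N X \<Longrightarrow> h \<in> definable_functions L N X
      \<Longrightarrow> e (\<lambda>a. c * g a + d * h a) = c * e g + d * e h"
    and nonneg: "\<And>g. g \<in> definable_functions L N X \<Longrightarrow> (\<And>a. a \<in> dom N X \<Longrightarrow> 0 \<le> g a) \<Longrightarrow> 0 \<le> e g"
    and one: "e (\<lambda>a. 1) = 1"
    and definable: "\<And>\<phi> i \<epsilon>. \<phi> \<in> L_formulas L \<Longrightarrow> 0 < \<epsilon> \<Longrightarrow> \<exists>\<psi>\<in>L_formulas L. \<forall>\<alpha>\<in>valuations N.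
      \<bar>e (\<lambda>a. fm_val N (\<alpha>((X, i) := a)) \<phi>) - fm_val N \<alpha> \<psi>\<bar> \<le> \<epsilon>"
begin

text \<open>
  Fixing the variable makes the definable functions a vector space without having to rename
  variables.
\<close>

definition definable_in :: "nat \<Rightarrow> ('a \<Rightarrow> real) \<Rightarrow> bool" where
  "definable_in i h \<longleftrightarrow> (\<forall>\<epsilon>>0. \<exists>\<phi>\<in>formulas_over L N X {i}. \<forall>\<alpha>\<in>valuations N. \<forall>a\<in>dom N X.
     \<bar>h a - fm_val N (\<alpha>((X, i) := a)) \<phi>\<bar> \<le> \<epsilon>)"

lemma definable_in_imp: "definable_in i h \<Longrightarrow> h \<in> definable_functions L N X"
  unfolding definable_in_def definable_functions_def by blast

lemma definable_in_const: "definable_in i (\<lambda>a. c)"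
  unfolding definable_in_def
  by (intro allI impI bexI[of _ "Const c"]) (auto simp: formulas_over_def)

lemma definable_in_linear:
  assumes g: "definable_in i g" and h: "definable_in i h"
  shows "definable_in i (\<lambda>a. c * g a + d * h a)"
  unfolding definable_in_def
proof (intro allI impI)
  fix \<epsilon> :: real assume "\<epsilon> > 0"
  \<comment> \<open>The summand 1 keeps the denominator positive when c and d both vanish.\<close>
  define \<eta> where "\<eta> = \<epsilon> / (\<bar>c\<bar> + \<bar>d\<bar> + 1)"
  have pos: "\<bar>c\<bar> + \<bar>d\<bar> + 1 > 0" by linarith
  then have "\<eta> > 0" using \<open>\<epsilon> > 0\<close> by (simp add: \<eta>_def)
  have "(\<bar>c\<bar> + \<bar>d\<bar> + 1) * \<eta> = \<epsilon>" using pos by (simp add: \<eta>_def)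
  then have \<eta>: "\<bar>c\<bar> * \<eta> + \<bar>d\<bar> * \<eta> \<le> \<epsilon>" using \<open>\<eta> > 0\<close> by (simp add: algebra_simps)
  obtain \<phi> where \<phi>: "\<phi> \<in> formulas_over L N X {i}"
    "\<forall>\<alpha>\<in>valuations N. \<forall>a\<in>dom N X. \<bar>g a - fm_val N (\<alpha>((X, i) := a)) \<phi>\<bar> \<le> \<eta>"
    using g \<open>\<eta> > 0\<close> unfolding definable_in_def by blast
  obtain \<psi> where \<psi>: "\<psi> \<in> formulas_over L N X {i}"
    "\<forall>\<alpha>\<in>valuations N. \<forall>a\<in>dom N X. \<bar>h a - fm_val N (\<alpha>((X, i) := a)) \<psi>\<bar> \<le> \<eta>"
    using h \<open>\<eta> > 0\<close> unfolding definable_in_def by blast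
  let ?\<theta> = "Conn (\<lambda>x y. c * x + d * y) \<phi> \<psi>"
  have "\<bar>c * g a + d * h a - fm_val N (\<alpha>((X, i) := a)) ?\<theta>\<bar> \<le> \<epsilon>"
    if "\<alpha> \<in> valuations N" "a \<in> dom N X" for \<alpha> a
  proof -
    let ?x = "g a - fm_val N (\<alpha>((X, i) := a)) \<phi>" and ?y = "h a - fm_val N (\<alpha>((X, i) := a)) \<psi>"
    have "c * g a + d * h a - fm_val N (\<alpha>((X, i) := a)) ?\<theta> = c * ?x + d * ?y"
      by (simp add: algebra_simps)
    also have "\<bar>\<dots>\<bar> \<le> \<bar>c\<bar> * \<bar>?x\<bar> + \<bar>d\<bar> * \<bar>?y\<bar>"
      by (metis abs_mult abs_triangle_ineq)
    also have "\<dots> \<le> \<bar>c\<bar> * \<eta> + \<bar>d\<bar> * \<eta>"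
      using \<phi>(2) \<psi>(2) that by (intro add_mono mult_left_mono) auto
    finally show ?thesis using \<eta> by linarith
  qed
  moreover have "continuous_on UNIV (\<lambda>(x, y). c * x + d * y :: real)"
    by (auto simp: case_prod_beta intro!: continuous_intros)
  then have "?\<theta> \<in> formulas_over L N X {i}"
    using \<phi>(1) \<psi>(1) by (auto simp: formulas_over_def)
  ultimately show "\<exists>\<phi>\<in>formulas_over L N X {i}. \<forall>\<alpha>\<in>valuations N. \<forall>a\<in>dom N X.
     \<bar>c * g a + d * h a - fm_val N (\<alpha>((X, i) := a)) \<phi>\<bar> \<le> \<epsilon>" by blast
qed

lemma e_const: "e (\<lambda>a. c) = c"
  using linear[of "\<lambda>a. 1" "\<lambda>a. 1" c 0] definable_in_imp[OF definable_in_const] one by simp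

lemma e_mono:
  assumes "definable_in i g" "definable_in i h" "\<And>a. a \<in> dom N X \<Longrightarrow> g a \<le> h a"
  shows "e g \<le> e h"
proof -
  have "0 \<le> e (\<lambda>a. 1 * h a + (- 1) * g a)"
    using assms by (intro nonneg definable_in_imp[OF definable_in_linear]) auto
  also have "\<dots> = 1 * e h + (- 1) * e g"
    using assms by (intro linear definable_in_imp)
  finally show ?thesis by simp
qed

text \<open>A positive normalized linear functional is a contraction for the uniform distance: apply
  monotonicity to \<open>g \<le> h + \<epsilon>\<close> and to
  \<open>h \<le> g + \<epsilon>\<close>, where the constant comes out because e of 1 is 1. The
  factors 1 in the proof give the sums the shape required by \<open>linear\<close>.\<close>

lemma e_close:
  assumes g: "definable_in i g" and h: "definable_in i h"
    and le: "\<And>a. a \<in> dom N X \<Longrightarrow> \<bar>g a - h a\<bar> \<le> \<epsilon>"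
  shows "\<bar>e g - e h\<bar> \<le> \<epsilon>"
proof -
  have shift: "definable_in i (\<lambda>a. 1 * f a + c * 1)" "e (\<lambda>a. 1 * f a + c * 1) = e f + c"
    if "definable_in i f" for f c
  proof -
    show "definable_in i (\<lambda>a. 1 * f a + c * 1)"
      by (rule definable_in_linear[OF that definable_in_const])
    show "e (\<lambda>a. 1 * f a + c * 1) = e f + c"
      using linear[OF definable_in_imp[OF that] definable_in_imp[OF definable_in_const], of 1 c 1] one
      by simp
  qed
  have "e g \<le> e (\<lambda>a. 1 * h a + \<epsilon> * 1)"
    using le by (intro e_mono[OF g shift(1)[OF h]]) (auto simp: abs_le_iff algebra_simps)
  moreover have "e h \<le> e (\<lambda>a. 1 * g a + \<epsilon> * 1)"
    using le by (intro e_mono[OF h shift(1)[OF g]]) (auto simp: abs_le_iff algebra_simps)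
  ultimately show ?thesis unfolding shift(2)[OF g] shift(2)[OF h] by linarith
qed

text \<open>Freezing every variable except \<open>x_i\<close> at its value under
  \<open>\<alpha>\<close> turns an approximating formula with arbitrary free variables into one over
  N in \<open>x_i\<close> alone.\<close>

lemma definable_in_if_approx:
  assumes \<alpha>: "\<alpha> \<in> valuations N"
    and approx: "\<And>\<epsilon>. \<epsilon> > 0 \<Longrightarrow> \<exists>\<psi>\<in>formulas_with_params L N. \<forall>a\<in>dom N X.
      \<bar>h a - fm_val N (\<alpha>((X, i) := a)) \<psi>\<bar> \<le> \<epsilon>"
  shows "definable_in i h"
  unfolding definable_in_def
proof (intro allI impI)
  fix \<epsilon> :: real assume "\<epsilon> > 0"
  then obtain \<psi> where \<psi>: "\<psi> \<in> formulas_with_params L N"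
    "\<forall>a\<in>dom N X. \<bar>h a - fm_val N (\<alpha>((X, i) := a)) \<psi>\<bar> \<le> \<epsilon>"
    using approx by blast
  let ?\<psi> = "fm_inst (- {(X, i)}) \<alpha> \<psi>"
  have "?\<psi> \<in> formulas_over L N X {i}"
    using fm_inst_with_params[OF \<psi>(1) \<alpha>] by (auto simp: formulas_over_iff fm_fv_inst)
  moreover have "fm_val N (\<beta>((X, i) := a)) ?\<psi> = fm_val N (\<alpha>((X, i) := a)) \<psi>" for \<beta> a
    unfolding fm_val_inst by (rule fm_val_cong) (auto simp: override_on_def)
  ultimately show "\<exists>\<phi>\<in>formulas_over L N X {i}. \<forall>\<beta>\<in>valuations N. \<forall>a\<in>dom N X.
     \<bar>h a - fm_val N (\<beta>((X, i) := a)) \<phi>\<bar> \<le> \<epsilon>" using \<psi>(2) by (intro bexI[of _ ?\<psi>]) auto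
qed

section \<open>Iteration of the expectation\<close>

abbreviation iter where "iter \<equiv> iterated_expectation X e"

text \<open>The base valuations may differ. F and G are compared only at modifications of
  \<open>\<alpha>\<close> and \<open>\<beta>\<close> that assign the same elements of the model to
  the iterated variables. This allows parameters to be moved into the valuation and variables into
  the formula.\<close>

lemma iter_cong:
  assumes "\<And>\<gamma> \<delta>. (\<And>v. v \<notin> {X} \<times> set is \<Longrightarrow> \<gamma> v = \<alpha> v \<and> \<delta> v = \<beta> v) \<Longrightarrow>
     (\<And>i. i \<in> set is \<Longrightarrow> \<gamma> (X, i) = \<delta> (X, i) \<and> \<gamma> (X, i) \<in> dom N X) \<Longrightarrow> F \<gamma> = G \<delta>"
  shows "iter is F \<alpha> = iter is G \<beta>"
  using assms
proof (induction "is" arbitrary: \<alpha> \<beta>)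
  case (Cons i "is")
  have "iter is F (\<alpha>((X, i) := a)) = iter is G (\<beta>((X, i) := a))" if a: "a \<in> dom N X" for a
  proof (rule Cons.IH)
    fix \<gamma> \<delta>
    assume off: "\<And>v. v \<notin> {X} \<times> set is \<Longrightarrow> \<gamma> v = (\<alpha>((X, i) := a)) v \<and> \<delta> v = (\<beta>((X, i) := a)) v"
      and on: "\<And>i. i \<in> set is \<Longrightarrow> \<gamma> (X, i) = \<delta> (X, i) \<and> \<gamma> (X, i) \<in> dom N X"
    show "F \<gamma> = G \<delta>"
    proof (rule Cons.prems)
      fix v assume "v \<notin> {X} \<times> set (i # is)"
      then show "\<gamma> v = \<alpha> v \<and> \<delta> v = \<beta> v" using off[of v] by (cases v) auto
    next
      fix j assume j: "j \<in> set (i # is)"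
      show "\<gamma> (X, j) = \<delta> (X, j) \<and> \<gamma> (X, j) \<in> dom N X"
      proof (cases "j \<in> set is")
        case False
        \<comment> \<open>Here j is the outermost variable i and is not bound again further in, so
          both valuations still give it the value a.\<close>
        then show ?thesis using j off[of "(X, j)"] a by auto
      qed (rule on)
    qed
  qed
  then show ?case by (auto intro: cong)
qed auto

lemma iter_append: "iter (js @ is) F \<alpha> = iter js (iter is F) \<alpha>"
  by (induction js arbitrary: \<alpha>) auto

lemma iter_const:
  assumes "\<And>\<gamma>. \<gamma> \<in> valuations N \<Longrightarrow> F \<gamma> = c" "\<alpha> \<in> valuations N"
  shows "iter is F \<alpha> = c"
  using assms(2)
proof (induction "is" arbitrary: \<alpha>)
  case (Cons i "is")
  have "e (\<lambda>a. iter is F (\<alpha>((X, i) := a))) = e (\<lambda>a. c)"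
    by (intro cong Cons.IH valuations_upd Cons.prems)
  then show ?case by (simp add: e_const)
qed (simp add: assms(1))

text \<open>Peel off the outermost expectation. The inner part is within
  \<open>\<epsilon> / 2\<close> of a formula, \<open>e_close\<close> carries this through e, and
  definability of the expectation of that formula costs the other half.\<close>

lemma iter_approx:
  assumes \<phi>: "\<phi> \<in> L_formulas L" and "\<epsilon> > 0"
  shows "\<exists>\<psi>\<in>L_formulas L. \<forall>\<alpha>\<in>valuations N.
    \<bar>iter is (\<lambda>\<beta>. fm_val N \<beta> \<phi>) \<alpha> - fm_val N \<alpha> \<psi>\<bar> \<le> \<epsilon>"
  using \<open>\<epsilon> > 0\<close>
proof (induction "is" arbitrary: \<epsilon>)
  case Nil
  then show ?case using \<phi> by (intro bexI[of _ \<phi>]) auto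
next
  case (Cons i "is")
  then have half: "\<epsilon> / 2 > 0" by simp
  obtain \<psi> where \<psi>: "\<psi> \<in> L_formulas L"
    "\<forall>\<alpha>\<in>valuations N. \<bar>iter is (\<lambda>\<beta>. fm_val N \<beta> \<phi>) \<alpha> - fm_val N \<alpha> \<psi>\<bar> \<le> \<epsilon> / 2"
    using Cons.IH[OF half] by blast
  obtain \<theta> where \<theta>: "\<theta> \<in> L_formulas L" "\<forall>\<alpha>\<in>valuations N.
      \<bar>e (\<lambda>a. fm_val N (\<alpha>((X, i) := a)) \<psi>) - fm_val N \<alpha> \<theta>\<bar> \<le> \<epsilon> / 2"
    using definable[OF \<psi>(1) half] by blast
  have "\<bar>iter (i # is) (\<lambda>\<beta>. fm_val N \<beta> \<phi>) \<alpha> - fm_val N \<alpha> \<theta>\<bar> \<le> \<epsilon>"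
    if \<alpha>: "\<alpha> \<in> valuations N" for \<alpha>
  proof -
    have "\<bar>e (\<lambda>a. iter is (\<lambda>\<beta>. fm_val N \<beta> \<phi>) (\<alpha>((X, i) := a)))
        - e (\<lambda>a. fm_val N (\<alpha>((X, i) := a)) \<psi>)\<bar> \<le> \<epsilon> / 2"
    proof (rule e_close)
      show "definable_in i (\<lambda>a. iter is (\<lambda>\<beta>. fm_val N \<beta> \<phi>) (\<alpha>((X, i) := a)))"
        \<comment> \<open>The induction hypothesis at every precision, not just at
          \<open>\<epsilon> / 2\<close>, shows that the inner function is definable, so that
          \<open>e_close\<close> applies to it.\<close>
        using Cons.IH valuations_upd[OF \<alpha>] L_formulas_with_params
        by (intro definable_in_if_approx[OF \<alpha>]) blast
      show "definable_in i (\<lambda>a. fm_val N (\<alpha>((X, i) := a)) \<psi>)"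
        using L_formulas_with_params[OF \<psi>(1)]
        by (intro definable_in_if_approx[OF \<alpha>]) (auto intro!: bexI[of _ \<psi>])
    qed (use \<psi>(2) valuations_upd[OF \<alpha>] in blast)
    moreover have "\<bar>e (\<lambda>a. fm_val N (\<alpha>((X, i) := a)) \<psi>) - fm_val N \<alpha> \<theta>\<bar> \<le> \<epsilon> / 2"
      using \<theta>(2) \<alpha> by blast
    ultimately show ?thesis unfolding iterated_expectation.simps by argo
  qed
  then show ?case using \<theta>(1) by blast
qed

text \<open>Turn the parameters into variables distinct from the iterated ones and from
  \<open>(X, i)\<close>. Restoring them then commutes with all updates, and
  \<open>iter_approx\<close> applies at the valuation that restores them.\<close>

lemma iter_definable:
  assumes \<phi>: "\<phi> \<in> formulas_with_params L N" and \<alpha>: "\<alpha> \<in> valuations N"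
  shows "definable_in i (\<lambda>a. iter is (\<lambda>\<beta>. fm_val N \<beta> \<phi>) (\<alpha>((X, i) := a)))"
proof -
  have "finite ({X} \<times> set (i # is))" by simp
  then obtain \<phi>' V \<kappa> where \<phi>': "\<phi>' \<in> L_formulas L" and V: "V \<inter> {X} \<times> set (i # is) = {}"
    and \<kappa>: "\<kappa> \<in> valuations N"
    and eq: "\<And>\<alpha>. fm_val N \<alpha> \<phi> = fm_val N (override_on \<alpha> \<kappa> V) \<phi>'"
    using parameter_abstraction[OF str \<phi>] by metis
  have it: "iter is (\<lambda>\<beta>. fm_val N \<beta> \<phi>) \<beta> = iter is (\<lambda>\<beta>. fm_val N \<beta> \<phi>') (override_on \<beta> \<kappa> V)" for \<beta>
  proof (rule iter_cong)
    fix \<gamma> \<delta>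
    assume off: "\<And>v. v \<notin> {X} \<times> set is \<Longrightarrow> \<gamma> v = \<beta> v \<and> \<delta> v = override_on \<beta> \<kappa> V v"
      and on: "\<And>i. i \<in> set is \<Longrightarrow> \<gamma> (X, i) = \<delta> (X, i) \<and> \<gamma> (X, i) \<in> dom N X"
    have "override_on \<gamma> \<kappa> V v = \<delta> v" for v
    proof (cases "v \<in> {X} \<times> set is")
      case True
      then show ?thesis using on V by (auto simp: override_on_def)
    next
      case False
      then show ?thesis using off[of v] by (auto simp: override_on_def)
    qed
    then show "fm_val N \<gamma> \<phi> = fm_val N \<delta> \<phi>'" unfolding eq by (intro fm_val_cong) auto
  qed
  have upd: "override_on (\<alpha>((X, i) := a)) \<kappa> V = (override_on \<alpha> \<kappa> V)((X, i) := a)" for a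
    using V by (auto simp: override_on_def)
  have \<alpha>': "override_on \<alpha> \<kappa> V \<in> valuations N" using \<alpha> \<kappa> by (rule valuations_override)
  show ?thesis
    unfolding it upd using iter_approx[OF \<phi>'] valuations_upd[OF \<alpha>'] L_formulas_with_params
    by (intro definable_in_if_approx[OF \<alpha>']) blast
qed

text \<open>Each outer expectation is compared with that of the zero function by
  \<open>e_close\<close>. A bound at the valuations in the model alone thus passes through all outer
  expectations.\<close>

lemma iter_bound:
  assumes \<phi>: "\<phi> \<in> formulas_with_params L N"
    and le: "\<And>\<beta>. \<beta> \<in> valuations N \<Longrightarrow> \<bar>iter is (\<lambda>\<beta>. fm_val N \<beta> \<phi>) \<beta>\<bar> \<le> \<epsilon>"
    and \<alpha>: "\<alpha> \<in> valuations N"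
  shows "\<bar>iter (js @ is) (\<lambda>\<beta>. fm_val N \<beta> \<phi>) \<alpha>\<bar> \<le> \<epsilon>"
  using \<alpha>
proof (induction js arbitrary: \<alpha>)
  case (Cons j js)
  have "\<bar>e (\<lambda>a. iter (js @ is) (\<lambda>\<beta>. fm_val N \<beta> \<phi>) (\<alpha>((X, j) := a))) - e (\<lambda>a. 0)\<bar> \<le> \<epsilon>"
    by (intro e_close[OF iter_definable[OF \<phi> Cons.prems] definable_in_const])
      (simp add: Cons.IH[OF valuations_upd[OF Cons.prems]] del: fun_upd_apply)
  then show ?case by (simp add: e_const)
qed (simp add: le)

text \<open>After all variables other than those of \<open>is\<close> are instantiated, the inner
  iteration no longer depends on the valuation, so the outer expectations see a constant and return
  it.\<close>

lemma iter_inst: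
  assumes "\<beta> \<in> valuations N"
  shows "iter (js @ is) (\<lambda>\<gamma>. fm_val N \<gamma> (fm_inst (- ({X} \<times> set is)) \<beta> \<phi>)) \<beta>
    = iter is (\<lambda>\<gamma>. fm_val N \<gamma> \<phi>) \<beta>"
  unfolding iter_append
proof (rule iter_const[OF _ assms], rule iter_cong)
  fix \<gamma>' \<gamma> \<delta>
  assume off: "\<And>v. v \<notin> {X} \<times> set is \<Longrightarrow> \<gamma> v = \<gamma>' v \<and> \<delta> v = \<beta> v"
    and on: "\<And>i. i \<in> set is \<Longrightarrow> \<gamma> (X, i) = \<delta> (X, i) \<and> \<gamma> (X, i) \<in> dom N X"
  have "override_on \<gamma> \<beta> (- ({X} \<times> set is)) v = \<delta> v" for v
    using on off by (cases v) (auto simp: override_on_def)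
  then show "fm_val N \<gamma> (fm_inst (- ({X} \<times> set is)) \<beta> \<phi>) = fm_val N \<delta> \<phi>"
    unfolding fm_val_inst by (intro fm_val_cong) auto
qed

end

section \<open>Conditional independence\<close>

lemma integrable_bounded_mult:
  fixes f g :: "'b \<Rightarrow> real"
  assumes "integrable M f" "g \<in> borel_measurable M" "\<And>x. x \<in> space M \<Longrightarrow> \<bar>g x\<bar> \<le> c"
  shows "integrable M (\<lambda>x. g x * f x)"
proof (rule Bochner_Integration.integrable_bound)
  show "integrable M (\<lambda>x. c * f x)" using assms(1) by simp
  show "AE x in M. norm (g x * f x) \<le> norm (c * f x)"
  proof (rule AE_I2)
    fix x assume "x \<in> space M"
    from assms(3)[OF this] have "\<bar>g x\<bar> \<le> \<bar>c\<bar>" by linarith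
    then show "norm (g x * f x) \<le> norm (c * f x)" by (simp add: abs_mult mult_right_mono)
  qed
qed (use assms in measurable)

lemma integral_bounded_mult_le:
  fixes f g :: "'b \<Rightarrow> real"
  assumes f: "integrable M f" and c: "\<And>x. x \<in> space M \<Longrightarrow> \<bar>g x\<bar> \<le> c" "0 \<le> c"
  shows "\<bar>\<integral>x. g x * f x \<partial>M\<bar> \<le> c * (\<integral>x. \<bar>f x\<bar> \<partial>M)"
proof -
  have "\<bar>\<integral>x. g x * f x \<partial>M\<bar> \<le> (\<integral>x. \<bar>g x * f x\<bar> \<partial>M)"
    using integral_norm_bound[of M "\<lambda>x. g x * f x"] by simp
  also have "\<dots> \<le> (\<integral>x. c * \<bar>f x\<bar> \<partial>M)"
    using f c by (intro integral_mono') (auto simp: abs_mult mult_right_mono)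
  finally show ?thesis by simp
qed

text \<open>The hypothesis \<open>eq\<close> says that E(f | C) has the defining property of E(f |
  B). By the tower rule for C inside B, E(fg | C) = E(g E(f | B) | C) = E(g E(f | C) | C), and the
  C-measurable factor E(f | C) can be taken out.\<close>

lemma independent_over_if_integral_eq:
  assumes "prob_space P" and A: "subalgebra P A" and B: "subalgebra P B" and C: "subalgebra P C"
    and CB: "subalgebra B C"
    and eq: "\<And>f S. f \<in> borel_measurable A \<Longrightarrow> bounded (f ` space P) \<Longrightarrow> S \<in> sets B \<Longrightarrow>
      (\<integral>p. indicator S p * f p \<partial>P) = (\<integral>p. indicator S p * real_cond_exp P C f p \<partial>P)"
  shows "independent_over P A B C"
proof -
  interpret prob_space P by fact
  interpret B: finite_measure_subalgebra P B by unfold_locales (fact B)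
  interpret C: finite_measure_subalgebra P C by unfold_locales (fact C)
  have "AE p in P. real_cond_exp P C (\<lambda>q. f q * g q) p = real_cond_exp P C f p * real_cond_exp P C g p"
    if f: "f \<in> borel_measurable A" and g: "g \<in> borel_measurable B"
      and fb: "bounded (f ` space P)" and gb: "bounded (g ` space P)" for f g :: "_ \<Rightarrow> real"
  proof -
    obtain c where c: "\<And>p. p \<in> space P \<Longrightarrow> \<bar>f p\<bar> \<le> c" using fb by (auto simp: bounded_iff)
    obtain d where d: "\<And>p. p \<in> space P \<Longrightarrow> \<bar>g p\<bar> \<le> d" using gb by (auto simp: bounded_iff)
    have fP [measurable]: "f \<in> borel_measurable P" by (rule measurable_from_subalg[OF A f])
    have gP [measurable]: "g \<in> borel_measurable P" by (rule measurable_from_subalg[OF B g])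
    have fi: "integrable P f" using c by (intro integrable_const_bound[of _ c]) auto
    have gi: "integrable P g" using d by (intro integrable_const_bound[of _ d]) auto
    have gf: "integrable P (\<lambda>p. g p * f p)" by (rule integrable_bounded_mult[OF fi gP d])
    have hi: "integrable P (real_cond_exp P C f)" by (rule C.real_cond_exp_int(1)[OF fi])
    have gh: "integrable P (\<lambda>p. g p * real_cond_exp P C f p)"
      by (rule integrable_bounded_mult[OF hi gP d])
    have hB: "real_cond_exp P C f \<in> borel_measurable B"
      by (rule measurable_from_subalg[OF CB]) simp
    have 1: "AE p in P. real_cond_exp P B f p = real_cond_exp P C f p"
    proof (rule B.real_cond_exp_charact[OF _ fi hi hB])
      fix S assume "S \<in> sets B"
      from eq[OF f fb this] show "(\<integral>p\<in>S. f p \<partial>P) = (\<integral>p\<in>S. real_cond_exp P C f p \<partial>P)"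
        by (simp add: set_lebesgue_integral_def)
    qed
    have 2: "AE p in P. real_cond_exp P B (\<lambda>q. g q * f q) p = g p * real_cond_exp P B f p"
      by (rule B.real_cond_exp_mult[OF g fP gf])
    have 3: "AE p in P. real_cond_exp P B (\<lambda>q. g q * f q) p = real_cond_exp P C f p * g p"
      using 1 2 by eventually_elim simp
    have 4: "AE p in P. real_cond_exp P C (real_cond_exp P B (\<lambda>q. g q * f q)) p
        = real_cond_exp P C (\<lambda>q. real_cond_exp P C f q * g q) p"
      by (rule C.real_cond_exp_cong[OF 3]) auto
    have 5: "AE p in P. real_cond_exp P C (real_cond_exp P B (\<lambda>q. g q * f q)) p
        = real_cond_exp P C (\<lambda>q. g q * f q) p"
      by (rule C.real_cond_exp_nested_subalg[OF B CB gf])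
    have 6: "AE p in P. real_cond_exp P C (\<lambda>q. real_cond_exp P C f q * g q) p
        = real_cond_exp P C f p * real_cond_exp P C g p"
      using gh by (intro C.real_cond_exp_mult) (auto simp: mult.commute)
    have "(\<lambda>q. f q * g q) = (\<lambda>q. g q * f q)" by (simp add: mult.commute)
    with 4 5 6 show ?thesis by (auto elim: eventually_elim2)
  qed
  then show ?thesis using A B C by (auto simp: independent_over_def)
qed

section \<open>Types and algebras generated by formulas\<close>

text \<open>Finite satisfiability at precision 1/(k+1) gives one sequence of valuations that works
  for all formulas of \<open>\<Phi>\<close> at once. Relations between values of formulas can then
  be passed to the limit.\<close>

lemma type_approximating_sequence:
  assumes p: "p \<in> types L N X u" and \<Phi>: "finite \<Phi>" "\<Phi> \<subseteq> formulas_over L N X u"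
  shows "\<exists>A. (\<forall>k. A k \<in> valuations N) \<and> (\<forall>\<phi>\<in>\<Phi>. (\<lambda>k. fm_val N (A k) \<phi>) \<longlonglongrightarrow> p \<phi>)"
proof -
  have "\<forall>k. \<exists>\<alpha>\<in>valuations N. \<forall>\<phi>\<in>\<Phi>. \<bar>p \<phi> - fm_val N \<alpha> \<phi>\<bar> < inverse (real (Suc k))"
    using p \<Phi> unfolding types_def by simp
  then obtain A where A: "\<And>k. A k \<in> valuations N"
    "\<And>k \<phi>. \<phi> \<in> \<Phi> \<Longrightarrow> \<bar>p \<phi> - fm_val N (A k) \<phi>\<bar> < inverse (real (Suc k))"
    by metis
  have "(\<lambda>k. fm_val N (A k) \<phi>) \<longlonglongrightarrow> p \<phi>" if "\<phi> \<in> \<Phi>" for \<phi>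
  proof (rule LIM_zero_cancel, rule Lim_null_comparison[OF _ LIMSEQ_inverse_real_of_nat])
    show "\<forall>\<^sub>F k in sequentially. norm (fm_val N (A k) \<phi> - p \<phi>) \<le> inverse (real (Suc k))"
      using A(2)[OF that] by (auto simp: abs_minus_commute less_imp_le)
  qed
  with A(1) show ?thesis by blast
qed

lemma type_Const:
  assumes "p \<in> types L N X u"
  shows "p (Const r) = r"
proof -
  have fin: "finite {Const r}" and sub: "{Const r} \<subseteq> formulas_over L N X u"
    by (simp_all add: formulas_over_def)
  obtain A where "\<And>k. A k \<in> valuations N"
    and A: "\<And>\<theta>. \<theta> \<in> {Const r} \<Longrightarrow> (\<lambda>k. fm_val N (A k) \<theta>) \<longlonglongrightarrow> p \<theta>"
    using type_approximating_sequence[OF assms fin sub] by metis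
  show ?thesis using A[of "Const r"] by (simp add: LIMSEQ_const_iff)
qed

text \<open>Approximate the compound formula and both components along the same sequence and use
  continuity of c.\<close>

lemma type_Conn:
  assumes p: "p \<in> types L N X u" and \<phi>: "Conn c \<phi> \<psi> \<in> formulas_over L N X u"
  shows "p (Conn c \<phi> \<psi>) = c (p \<phi>) (p \<psi>)"
proof -
  have fin: "finite {Conn c \<phi> \<psi>, \<phi>, \<psi>}" by simp
  have sub: "{Conn c \<phi> \<psi>, \<phi>, \<psi>} \<subseteq> formulas_over L N X u"
    using \<phi> by (auto simp: formulas_over_def)
  obtain A where "\<And>k. A k \<in> valuations N"
    and A: "\<And>\<theta>. \<theta> \<in> {Conn c \<phi> \<psi>, \<phi>, \<psi>} \<Longrightarrow> (\<lambda>k. fm_val N (A k) \<theta>) \<longlonglongrightarrow> p \<theta>"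
    using type_approximating_sequence[OF p fin sub] by metis
  have "isCont (\<lambda>(x, y). c x y) (p \<phi>, p \<psi>)"
    using \<phi> by (auto simp: formulas_over_def continuous_on_eq_continuous_at)
  from isCont_tendsto_compose[OF this tendsto_Pair[OF A A]]
  have "(\<lambda>k. fm_val N (A k) (Conn c \<phi> \<psi>)) \<longlonglongrightarrow> c (p \<phi>) (p \<psi>)" by simp
  moreover have "(\<lambda>k. fm_val N (A k) (Conn c \<phi> \<psi>)) \<longlonglongrightarrow> p (Conn c \<phi> \<psi>)" by (rule A) simp
  ultimately show ?thesis by (rule LIMSEQ_unique[rotated])
qed

lemma type_bound:
  assumes p: "p \<in> types L N X u" and \<phi>: "\<phi> \<in> formulas_over L N X u"
    and B: "\<And>\<alpha>. \<alpha> \<in> valuations N \<Longrightarrow> \<bar>fm_val N \<alpha> \<phi>\<bar> \<le> B"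
  shows "\<bar>p \<phi>\<bar> \<le> B"
proof -
  have fin: "finite {\<phi>}" and sub: "{\<phi>} \<subseteq> formulas_over L N X u" using \<phi> by simp_all
  obtain A where A: "\<And>k. A k \<in> valuations N"
    "\<And>\<theta>. \<theta> \<in> {\<phi>} \<Longrightarrow> (\<lambda>k. fm_val N (A k) \<theta>) \<longlonglongrightarrow> p \<theta>"
    using type_approximating_sequence[OF p fin sub] by metis
  show ?thesis
    by (rule LIMSEQ_le_const2[OF tendsto_rabs[OF A(2)]]) (use A(1) B in auto)
qed

lemma restrict_type:
  assumes "p \<in> types L N X u" "v \<subseteq> u"
  shows "restrict p (formulas_over L N X v) \<in> types L N X v"
proof -
  have sub: "formulas_over L N X v \<subseteq> formulas_over L N X u"
    using assms(2) by (auto simp: formulas_over_def)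
  have "\<exists>\<alpha>\<in>valuations N. \<forall>\<phi>\<in>\<Phi>. \<bar>restrict p (formulas_over L N X v) \<phi> - fm_val N \<alpha> \<phi>\<bar> < \<epsilon>"
    if "finite \<Phi>" "\<Phi> \<subseteq> formulas_over L N X v" "\<epsilon> > 0" for \<Phi> and \<epsilon> :: real
  proof -
    have "\<exists>\<alpha>\<in>valuations N. \<forall>\<phi>\<in>\<Phi>. \<bar>p \<phi> - fm_val N \<alpha> \<phi>\<bar> < \<epsilon>"
      using assms(1) that sub unfolding types_def by blast
    moreover have "restrict p (formulas_over L N X v) \<phi> = p \<phi>" if "\<phi> \<in> \<Phi>" for \<phi>
      using that \<open>\<Phi> \<subseteq> _\<close> by auto
    ultimately show ?thesis by auto
  qed
  then show ?thesis by (simp add: types_def)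
qed

text \<open>All the sigma-algebras involved take this form on the types in
  \<open>x_1, ..., x_n\<close>: \<open>L_v\<close> has K the formulas in the variables of v, and a
  join of several \<open>L_v\<close> has K the union of these sets. Inclusions then reduce to
  inclusions between sets of formulas.\<close>

definition evaluation_algebra ::
  "('s, 'f, 'p) language \<Rightarrow> ('s, 'f, 'p, 'a) struct \<Rightarrow> 's \<Rightarrow> nat set
     \<Rightarrow> ('s, 'f, 'p, 'a) fm set \<Rightarrow> (('s, 'f, 'p, 'a) fm \<Rightarrow> real) measure" where
  "evaluation_algebra L N X u K =
     sigma (types L N X u) {{p \<in> types L N X u. p \<phi> \<le> r} | \<phi> r. \<phi> \<in> K}"

lemma space_evaluation_algebra [simp]: "space (evaluation_algebra L N X u K) = types L N X u"
  by (simp add: evaluation_algebra_def space_measure_of_conv)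

lemma sets_evaluation_algebra:
  "sets (evaluation_algebra L N X u K)
     = sigma_sets (types L N X u) {{p \<in> types L N X u. p \<phi> \<le> r} | \<phi> r. \<phi> \<in> K}"
  by (auto simp: evaluation_algebra_def intro!: sets_measure_of)

lemma sets_evaluation_algebra_mono:
  "K \<subseteq> K' \<Longrightarrow> sets (evaluation_algebra L N X u K) \<subseteq> sets (evaluation_algebra L N X u K')"
  unfolding sets_evaluation_algebra by (intro sigma_sets_mono') blast

lemma measurable_evaluation:
  "\<phi> \<in> K \<Longrightarrow> (\<lambda>p. p \<phi>) \<in> borel_measurable (evaluation_algebra L N X u K)"
  by (intro borel_measurableI_le) (auto simp: sets_evaluation_algebra)

lemma sets_evaluation_algebra_subset:
  assumes "space M = types L N X u" "\<And>\<phi>. \<phi> \<in> K \<Longrightarrow> (\<lambda>p. p \<phi>) \<in> borel_measurable M"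
  shows "sets (evaluation_algebra L N X u K) \<subseteq> sets M"
  unfolding sets_evaluation_algebra assms(1)[symmetric]
  by (rule sets.sigma_sets_subset) (use assms in \<open>auto simp: borel_measurable_iff_le\<close>)

lemma type_space_eq: "type_space L N X u = evaluation_algebra L N X u (formulas_over L N X u)"
  by (simp add: type_space_def evaluation_algebra_def)

text \<open>Restriction does not change the value of a type at a formula in the variables of v, so
  generators pull back to generators, and pulling back commutes with generating a
  sigma-algebra.\<close>

lemma formula_algebra_eq:
  assumes "v \<subseteq> {1..n}"
  shows "formula_algebra L N X n v = evaluation_algebra L N X {1..n} (formulas_over L N X v)"
proof -
  let ?r = "\<lambda>p. restrict p (formulas_over L N X v)" and ?\<Omega> = "types L N X {1..n}"
  let ?G = "{{p \<in> types L N X v. p \<phi> \<le> r} | \<phi> r. \<phi> \<in> formulas_over L N X v}"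
  have pull: "?r -` {p \<in> types L N X v. p \<phi> \<le> r} \<inter> ?\<Omega> = {p \<in> ?\<Omega>. p \<phi> \<le> r}"
    if "\<phi> \<in> formulas_over L N X v" for \<phi> r
    using that restrict_type[OF _ assms] by auto
  have "{?r -` A \<inter> ?\<Omega> | A. A \<in> ?G} = {{p \<in> ?\<Omega>. p \<phi> \<le> r} | \<phi> r. \<phi> \<in> formulas_over L N X v}"
    (is "?lhs = ?rhs")
  proof
    show "?lhs \<subseteq> ?rhs" using pull by blast
    show "?rhs \<subseteq> ?lhs"
    proof
      fix S assume "S \<in> ?rhs"
      then obtain \<phi> r where "\<phi> \<in> formulas_over L N X v" "S = {p \<in> ?\<Omega>. p \<phi> \<le> r}" by blast
      then show "S \<in> ?lhs" using pull[of \<phi> r, symmetric] by blast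
    qed
  qed
  moreover have "formula_algebra L N X n v = sigma ?\<Omega> {?r -` A \<inter> ?\<Omega> | A. A \<in> ?G}"
    unfolding formula_algebra_def type_space_def
    by (rule vimage_algebra_sigma) (use restrict_type[OF _ assms] in auto)
  ultimately show ?thesis by (simp add: evaluation_algebra_def)
qed

lemma sets_generated_formula_algebras:
  assumes "space P = types L N X {1..n}" "V \<subseteq> Pow {1..n}"
  shows "sets (generated_algebra P (formula_algebra L N X n ` V))
    = sets (evaluation_algebra L N X {1..n} (\<Union>v\<in>V. formulas_over L N X v))" (is "?lhs = ?rhs")
proof
  have sub: "sets (formula_algebra L N X n v) \<subseteq> ?rhs" if "v \<in> V" for v
  proof -
    have "v \<subseteq> {1..n}" using that assms(2) by blast
    moreover have "formulas_over L N X v \<subseteq> (\<Union>v\<in>V. formulas_over L N X v)" using that by blast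
    ultimately show ?thesis by (simp only: formula_algebra_eq sets_evaluation_algebra_mono)
  qed
  \<comment> \<open>\<open>sigma\<close> yields the generated sigma-algebra only if its generators
    are subsets of the space.\<close>
  have pow: "(\<Union>A\<in>formula_algebra L N X n ` V. sets A) \<subseteq> Pow (types L N X {1..n})"
    using sub sets.space_closed[of "evaluation_algebra L N X {1..n} (\<Union>v\<in>V. formulas_over L N X v)"]
    unfolding space_evaluation_algebra by blast
  then have lhs: "?lhs = sigma_sets (types L N X {1..n}) (\<Union>A\<in>formula_algebra L N X n ` V. sets A)"
    unfolding generated_algebra_def assms(1) by (rule sets_measure_of)
  show "?lhs \<subseteq> ?rhs"
  proof -
    have "(\<Union>A\<in>formula_algebra L N X n ` V. sets A) \<subseteq> ?rhs" using sub by blast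
    from sets.sigma_sets_subset[OF this] show ?thesis
      unfolding lhs space_evaluation_algebra .
  qed
  show "?rhs \<subseteq> ?lhs"
  proof (rule sets_evaluation_algebra_subset)
    show "space (generated_algebra P (formula_algebra L N X n ` V)) = types L N X {1..n}"
      using assms(1) by (simp add: generated_algebra_def space_measure_of_conv)
    fix \<phi> assume "\<phi> \<in> (\<Union>v\<in>V. formulas_over L N X v)"
    then obtain v where v: "v \<in> V" "\<phi> \<in> formulas_over L N X v" by blast
    have "v \<subseteq> {1..n}" using v(1) assms(2) by blast
    then have "(\<lambda>p. p \<phi>) \<in> borel_measurable (formula_algebra L N X n v)"
      by (simp only: formula_algebra_eq measurable_evaluation[OF v(2)])
    moreover have "sets (formula_algebra L N X n v) \<subseteq> ?lhs"
      using v(1) unfolding lhs by (auto intro: sigma_sets.Basic)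
    moreover have "space (formula_algebra L N X n v) = types L N X {1..n}"
      by (simp add: formula_algebra_def)
    ultimately show "(\<lambda>p. p \<phi>) \<in> borel_measurable (generated_algebra P (formula_algebra L N X n ` V))"
      using assms(1) by (auto simp: measurable_def generated_algebra_def space_measure_of_conv)
  qed
qed

section \<open>The measure on the space of types\<close>

locale type_measure = expectation L N X e + prob_space P
  for L :: "('s, 'f, 'p) language" and N :: "('s, 'f, 'p, 'a) struct" and X e
    and P :: "(('s, 'f, 'p, 'a) fm \<Rightarrow> real) measure" +
  fixes n :: nat
  assumes space_P: "space P = types L N X {1..n}"
    and sets_P: "sets P = sets (type_space L N X {1..n})"
    and integral_P: "\<And>\<phi> \<alpha>. \<phi> \<in> formulas_over L N X {1..n} \<Longrightarrow> \<alpha> \<in> valuations N \<Longrightarrow>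
      (\<integral>p. p \<phi> \<partial>P) = iterated_expectation X e (sorted_list_of_set {1..n}) (\<lambda>\<beta>. fm_val N \<beta> \<phi>) \<alpha>"
    and fubini: "\<And>is js \<phi> \<alpha>. distinct is \<Longrightarrow> distinct js \<Longrightarrow> set is = set js \<Longrightarrow>
      \<phi> \<in> formulas_over L N X (set is) \<Longrightarrow> \<alpha> \<in> valuations N \<Longrightarrow>
      iterated_expectation X e is (\<lambda>\<beta>. fm_val N \<beta> \<phi>) \<alpha>
        = iterated_expectation X e js (\<lambda>\<beta>. fm_val N \<beta> \<phi>) \<alpha>"
begin

section \<open>Density of formulas in L1\<close>

abbreviation F where "F \<equiv> formulas_over L N X"

abbreviation alg where "alg \<equiv> evaluation_algebra L N X {1..n}"

text \<open>Evaluations of such a set are closed under sums, products and lattice operations and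
  contain the constants, which is what a density argument uses. The notion is isolated because
  density is also applied to sets of formulas other than the \<open>F u\<close>.\<close>

definition conn_closed :: "('s, 'f, 'p, 'a) fm set \<Rightarrow> bool" where
  "conn_closed K \<longleftrightarrow> K \<subseteq> F {1..n} \<and> (\<forall>r. Const r \<in> K) \<and>
     (\<forall>c. continuous_on UNIV (\<lambda>(x, y). c x y) \<longrightarrow> (\<forall>\<phi>\<in>K. \<forall>\<psi>\<in>K. Conn c \<phi> \<psi> \<in> K))"

text \<open>Membership in the L1 closure of the evaluations of K. It is meaningful for integrable f,
  as the Bochner integral of a non-integrable function is 0.\<close>

definition approximable :: "('s, 'f, 'p, 'a) fm set \<Rightarrow> ((('s, 'f, 'p, 'a) fm \<Rightarrow> real) \<Rightarrow> real) \<Rightarrow> bool"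
  where "approximable K f \<longleftrightarrow> (\<forall>\<epsilon>>0. \<exists>\<phi>\<in>K. (\<integral>p. \<bar>f p - p \<phi>\<bar> \<partial>P) < \<epsilon>)"

lemma formulas_over_mono: "u \<subseteq> v \<Longrightarrow> F u \<subseteq> F v"
  by (auto simp: formulas_over_def)

lemma conn_closed_formulas_over: "u \<subseteq> {1..n} \<Longrightarrow> conn_closed (F u)"
  using formulas_over_mono[of u "{1..n}"] by (auto simp: conn_closed_def formulas_over_def)

lemma eval_measurable: "\<phi> \<in> F {1..n} \<Longrightarrow> (\<lambda>p. p \<phi>) \<in> borel_measurable P"
  using measurable_evaluation[of \<phi> "F {1..n}" L N X "{1..n}"]
    measurable_cong_sets[OF sets_P refl] by (auto simp: type_space_eq)

lemma subalgebra_alg: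
  assumes "K \<subseteq> F {1..n}"
  shows "subalgebra P (alg K)"
  unfolding subalgebra_def
  using sets_evaluation_algebra_subset[OF space_P] eval_measurable assms
  by (auto simp: space_P subset_iff)

lemma eval_bounded:
  assumes "\<phi> \<in> F {1..n}"
  shows "\<exists>B. \<forall>p\<in>space P. \<bar>p \<phi>\<bar> \<le> B"
proof -
  obtain B where "\<forall>\<alpha>\<in>valuations N. \<bar>fm_val N \<alpha> \<phi>\<bar> \<le> B"
    using bounded_fm_val[OF str] assms unfolding formulas_over_iff by blast
  then show ?thesis using type_bound[OF _ assms] space_P by blast
qed

lemma eval_integrable:
  assumes "\<phi> \<in> F {1..n}"
  shows "integrable P (\<lambda>p. p \<phi>)"
proof -
  obtain B where "\<forall>p\<in>space P. \<bar>p \<phi>\<bar> \<le> B" using eval_bounded[OF assms] by blast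
  then show ?thesis
    using eval_measurable[OF assms] by (intro integrable_const_bound[of _ B]) auto
qed

lemma eval_Conn:
  assumes "conn_closed K" "\<phi> \<in> K" "\<psi> \<in> K" "continuous_on UNIV (\<lambda>(x, y). c x y)" "p \<in> space P"
  shows "Conn c \<phi> \<psi> \<in> K" "p (Conn c \<phi> \<psi>) = c (p \<phi>) (p \<psi>)"
\<comment> \<open>The assumption on p is shared by both conclusions, so uses of the first one below
  supply a point through \<open>not_empty\<close>.\<close>
proof -
  show K: "Conn c \<phi> \<psi> \<in> K" using assms(1-4) unfolding conn_closed_def by blast
  then have "Conn c \<phi> \<psi> \<in> F {1..n}" using assms(1) unfolding conn_closed_def by blast
  then show "p (Conn c \<phi> \<psi>) = c (p \<phi>) (p \<psi>)"
    using assms(5) unfolding space_P by (rule type_Conn[rotated])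
qed

lemma approximable_eval: "\<phi> \<in> K \<Longrightarrow> approximable K (\<lambda>p. p \<phi>)"
  unfolding approximable_def by (auto intro!: bexI[of _ \<phi>])

lemma approximable_cong:
  assumes "approximable K f" "\<And>p. p \<in> space P \<Longrightarrow> f p = g p"
  shows "approximable K g"
proof -
  have "(\<integral>p. \<bar>g p - p \<phi>\<bar> \<partial>P) = (\<integral>p. \<bar>f p - p \<phi>\<bar> \<partial>P)" for \<phi>
    using assms(2) by (intro Bochner_Integration.integral_cong) auto
  then show ?thesis using assms(1) by (simp add: approximable_def)
qed

lemma approximable_const: "conn_closed K \<Longrightarrow> approximable K (\<lambda>p. r)"
  by (rule approximable_cong[OF approximable_eval[of "Const r" K]])
    (auto simp: conn_closed_def space_P type_Const)

text \<open>Apply the connective c to the approximating formulas; the L1 error grows at most by the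
  Lipschitz constant. Sums, scalar multiples, complements and finite unions are instances.\<close>

lemma approximable_Lipschitz:
  assumes K: "conn_closed K" and c: "continuous_on UNIV (\<lambda>(x, y). c x y :: real)"
    and B: "0 \<le> B" "\<And>x y x' y'. \<bar>c x y - c x' y'\<bar> \<le> B * (\<bar>x - x'\<bar> + \<bar>y - y'\<bar>)"
    and f: "approximable K f" "integrable P f" and g: "approximable K g" "integrable P g"
  shows "approximable K (\<lambda>p. c (f p) (g p))"
  unfolding approximable_def
proof (intro allI impI)
  fix \<epsilon> :: real assume "\<epsilon> > 0"
  \<comment> \<open>With \<open>B + 1\<close> in place of B the final inequality is strict, and the
    quotient makes sense for \<open>B = 0\<close>.\<close>
  define \<eta> where "\<eta> = \<epsilon> / (2 * (B + 1))"
  have "\<eta> > 0" using \<open>\<epsilon> > 0\<close> B(1) by (simp add: \<eta>_def)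
  have "2 * (B + 1) \<noteq> 0" using B(1) by simp
  then have "\<epsilon> = \<eta> * (2 * (B + 1))"
    by (rule nonzero_divide_eq_eq[THEN iffD1]) (simp only: \<eta>_def)
  then have \<eta>: "B * (2 * \<eta>) < \<epsilon>" using \<open>\<eta> > 0\<close> by (simp add: algebra_simps)
  obtain \<phi> where \<phi>: "\<phi> \<in> K" "(\<integral>p. \<bar>f p - p \<phi>\<bar> \<partial>P) < \<eta>"
    using f(1) \<open>\<eta> > 0\<close> unfolding approximable_def by blast
  obtain \<psi> where \<psi>: "\<psi> \<in> K" "(\<integral>p. \<bar>g p - p \<psi>\<bar> \<partial>P) < \<eta>"
    using g(1) \<open>\<eta> > 0\<close> unfolding approximable_def by blast
  have int: "integrable P (\<lambda>p. \<bar>f p - p \<phi>\<bar>)" "integrable P (\<lambda>p. \<bar>g p - p \<psi>\<bar>)"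
    using f(2) g(2) \<phi>(1) \<psi>(1) K eval_integrable unfolding conn_closed_def by auto
  have "(\<integral>p. \<bar>c (f p) (g p) - p (Conn c \<phi> \<psi>)\<bar> \<partial>P)
      \<le> (\<integral>p. B * (\<bar>f p - p \<phi>\<bar> + \<bar>g p - p \<psi>\<bar>) \<partial>P)"
    using B int by (intro integral_mono') (auto simp: eval_Conn(2)[OF K \<phi>(1) \<psi>(1) c])
  also have "\<dots> = B * ((\<integral>p. \<bar>f p - p \<phi>\<bar> \<partial>P) + (\<integral>p. \<bar>g p - p \<psi>\<bar> \<partial>P))"
    using int by simp
  also have "\<dots> \<le> B * (2 * \<eta>)" using \<phi>(2) \<psi>(2) B(1) by (intro mult_left_mono) auto
  finally have "(\<integral>p. \<bar>c (f p) (g p) - p (Conn c \<phi> \<psi>)\<bar> \<partial>P) < \<epsilon>" using \<eta> by linarith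
  moreover have "Conn c \<phi> \<psi> \<in> K" using K c \<phi>(1) \<psi>(1) unfolding conn_closed_def by blast
  ultimately show "\<exists>\<phi>\<in>K. (\<integral>p. \<bar>c (f p) (g p) - p \<phi>\<bar> \<partial>P) < \<epsilon>" by blast
qed

text \<open>Dominated convergence turns the pointwise limit into an L1 limit, and an L1 closure is
  closed.\<close>

lemma approximable_dominated_limit:
  assumes K: "conn_closed K" and s: "\<And>k. approximable K (s k)" "\<And>k. s k \<in> borel_measurable P"
    and w: "integrable P w" "\<And>k p. p \<in> space P \<Longrightarrow> \<bar>s k p\<bar> \<le> w p"
    and f: "f \<in> borel_measurable P" "\<And>p. p \<in> space P \<Longrightarrow> (\<lambda>k. s k p) \<longlonglongrightarrow> f p"
  shows "approximable K f"
  unfolding approximable_def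
proof (intro allI impI)
  fix \<epsilon> :: real assume "\<epsilon> > 0"
  have fw: "\<bar>f p\<bar> \<le> w p" if "p \<in> space P" for p
    using LIMSEQ_le_const2[OF tendsto_rabs[OF f(2)[OF that]]] w(2)[OF that] by blast
  have lim: "(\<lambda>k. \<integral>p. \<bar>f p - s k p\<bar> \<partial>P) \<longlonglongrightarrow> (\<integral>p. 0 \<partial>P)"
  proof (rule integral_dominated_convergence)
    show "integrable P (\<lambda>p. 2 * w p)" using w(1) by simp
    show "AE p in P. (\<lambda>k. \<bar>f p - s k p\<bar>) \<longlonglongrightarrow> 0"
    proof (rule AE_I2)
      fix p assume "p \<in> space P"
      from tendsto_rabs[OF tendsto_diff[OF tendsto_const f(2)[OF this], of "f p"]]
      show "(\<lambda>k. \<bar>f p - s k p\<bar>) \<longlonglongrightarrow> 0" by simp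
    qed
    show "AE p in P. norm \<bar>f p - s k p\<bar> \<le> 2 * w p" for k
    proof (rule AE_I2)
      fix p assume "p \<in> space P"
      from fw[OF this] w(2)[OF this, of k] show "norm \<bar>f p - s k p\<bar> \<le> 2 * w p" by simp
    qed
  qed (use s(2) f(1) in auto)
  then obtain k where k: "(\<integral>p. \<bar>f p - s k p\<bar> \<partial>P) < \<epsilon> / 2"
    using \<open>\<epsilon> > 0\<close> order_tendstoD(2)[OF lim, of "\<epsilon> / 2"] by (auto simp: eventually_sequentially)
  obtain \<phi> where \<phi>: "\<phi> \<in> K" "(\<integral>p. \<bar>s k p - p \<phi>\<bar> \<partial>P) < \<epsilon> / 2"
    using s(1) \<open>\<epsilon> > 0\<close> unfolding approximable_def by (meson half_gt_zero)
  have wb: "integrable P (s k)" "integrable P f"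
    using s(2) f(1) order_trans[OF w(2) abs_ge_self] order_trans[OF fw abs_ge_self]
    by (auto intro!: Bochner_Integration.integrable_bound[OF w(1)] AE_I2)
  then have int: "integrable P (\<lambda>p. \<bar>f p - s k p\<bar>)" "integrable P (\<lambda>p. \<bar>s k p - p \<phi>\<bar>)"
    using \<phi>(1) K eval_integrable unfolding conn_closed_def by auto
  have "(\<integral>p. \<bar>f p - p \<phi>\<bar> \<partial>P) \<le> (\<integral>p. \<bar>f p - s k p\<bar> + \<bar>s k p - p \<phi>\<bar> \<partial>P)"
    using int by (intro integral_mono') auto
  also have "\<dots> < \<epsilon>" using int k \<phi>(2) by simp
  finally show "\<exists>\<phi>\<in>K. (\<integral>p. \<bar>f p - p \<phi>\<bar> \<partial>P) < \<epsilon>" using \<phi>(1) by blast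
qed

lemma approximable_sublevel:
  assumes K: "conn_closed K" and \<phi>: "\<phi> \<in> K"
  shows "approximable K (indicator {p \<in> types L N X {1..n}. p \<phi> \<le> r})"
proof -
  \<comment> \<open>For positive k a continuous ramp, equal to 1 up to r and to 0 from r + 1/k on;
    pointwise it tends to the indicator of the half-line up to r. As a binary connective it ignores
    its second argument.\<close>
  define s where "s k x = max 0 (min 1 (1 - real k * (x - r)))" for k x
  have cont: "continuous_on UNIV (\<lambda>(x, y). s k x)" for k
    unfolding s_def case_prod_beta by (intro continuous_intros)
  have \<phi>F: "\<phi> \<in> F {1..n}" using K \<phi> by (auto simp: conn_closed_def)
  note [measurable] = eval_measurable[OF \<phi>F]
  show ?thesis
  proof (rule approximable_dominated_limit[OF K])
    show "approximable K (\<lambda>p. s k (p \<phi>))" for k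
    proof (rule approximable_cong[OF approximable_eval])
      show "Conn (\<lambda>x y. s k x) \<phi> \<phi> \<in> K"
        using K \<phi> cont unfolding conn_closed_def by blast
      show "p (Conn (\<lambda>x y. s k x) \<phi> \<phi>) = s k (p \<phi>)" if "p \<in> space P" for p
        using eval_Conn(2)[OF K \<phi> \<phi> cont that] .
    qed
    show "integrable P (\<lambda>p. 1 :: real)" by simp
    show "\<bar>s k (p \<phi>)\<bar> \<le> 1" for k p by (simp add: s_def)
    show "(\<lambda>p. s k (p \<phi>)) \<in> borel_measurable P" for k unfolding s_def by measurable
    have "{p \<in> types L N X {1..n}. p \<phi> \<le> r} \<in> sets P" unfolding space_P[symmetric] by measurable
    then show "indicator {p \<in> types L N X {1..n}. p \<phi> \<le> r} \<in> borel_measurable P" by simp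
  next
    fix p assume p: "p \<in> space P"
    show "(\<lambda>k. s k (p \<phi>)) \<longlonglongrightarrow> indicator {p \<in> types L N X {1..n}. p \<phi> \<le> r} p"
    proof (cases "p \<phi> \<le> r")
      case True
      then have "real k * (p \<phi> - r) \<le> 0" for k by (simp add: mult_nonneg_nonpos)
      then have "s k (p \<phi>) = 1" for k using s_def[of k "p \<phi>"] by (smt (verit))
      then show ?thesis using True p by (simp add: space_P)
    next
      case False
      then obtain m where m: "real m * (p \<phi> - r) > 1"
        using reals_Archimedean3[of "p \<phi> - r"] by auto
      have "s k (p \<phi>) = 0" if "k \<ge> m" for k
      proof -
        have "real m * (p \<phi> - r) \<le> real k * (p \<phi> - r)"
          using that False by (intro mult_right_mono) auto
        with m show ?thesis by (simp add: s_def)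
      qed
      then have "\<forall>\<^sub>F k in sequentially. s k (p \<phi>) = 0" by (auto simp: eventually_sequentially)
      then show ?thesis using False by (simp add: tendsto_eventually)
    qed
  qed
qed

lemma approximable_indicator:
  assumes K: "conn_closed K" and S: "S \<in> sets (alg K)"
  shows "approximable K (indicator S)"
proof -
  have KF: "K \<subseteq> F {1..n}" using K by (simp add: conn_closed_def)
  have sets: "S \<in> sets P" if "S \<in> sets (alg K)" for S
    using that subalgebra_alg[OF KF] by (auto simp: subalgebra_def)
  have int: "integrable P (indicator S :: _ \<Rightarrow> real)" if "S \<in> sets P" for S
    using that by (intro integrable_const_bound[of _ 1]) auto
  \<comment> \<open>Membership in \<open>sets P\<close> is carried through the induction to keep the
    indicators integrable in the Lipschitz steps.\<close>
  have "S \<in> sets P \<and> approximable K (indicator S)" using S unfolding sets_evaluation_algebra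
  proof (induction S rule: sigma_sets.induct)
    case (Basic A)
    then show ?case
      using approximable_sublevel[OF K] sets
      by (auto simp: sets_evaluation_algebra intro: sigma_sets.Basic)
  next
    case Empty
    then show ?case using approximable_const[OF K, of 0] by (simp add: indicator_def)
  next
    case (Compl A)
    have "continuous_on UNIV (\<lambda>(x, y). 1 - x :: real)"
      unfolding case_prod_beta by (intro continuous_intros)
    then have "approximable K (\<lambda>p. (\<lambda>x y. 1 - x) (indicator A p) (indicator A p))"
      by (rule approximable_Lipschitz[OF K, of _ 1]) (use Compl.IH int in auto)
    then have "approximable K (indicator (types L N X {1..n} - A))"
      by (rule approximable_cong) (auto simp: space_P indicator_def)
    moreover have "types L N X {1..n} - A \<in> sets P"
      using Compl unfolding space_P[symmetric] by auto
    ultimately show ?case by blast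
  next
    case (Union A)
    \<comment> \<open>Finite unions come from the connective max, with no disjointness; the
      countable union is their dominated limit.\<close>
    have fin: "approximable K (indicator (\<Union>i<k. A i))" for k
    proof (induction k)
      case 0
      then show ?case using approximable_const[OF K, of 0] by (simp add: indicator_def)
    next
      case (Suc k)
      have "continuous_on UNIV (\<lambda>(x, y). max x y :: real)"
        unfolding case_prod_beta by (intro continuous_intros)
      moreover have "\<bar>max x y - max x' y'\<bar> \<le> 1 * (\<bar>x - x'\<bar> + \<bar>y - y'\<bar>)" for x y x' y' :: real
        by (smt (verit))
      moreover have "(\<Union>i<k. A i) \<in> sets P" using Union.IH by auto
      ultimately have "approximable K (\<lambda>p. max (indicator (\<Union>i<k. A i) p) (indicator (A k) p :: real))"
        using Suc Union.IH int by (intro approximable_Lipschitz[OF K, of max 1]) auto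
      then show ?case
        by (rule approximable_cong) (auto simp: indicator_def less_Suc_eq)
    qed
    have "approximable K (indicator (\<Union>i. A i))"
    proof (rule approximable_dominated_limit[OF K fin])
      show "integrable P (\<lambda>p. 1 :: real)" by simp
      show "(\<lambda>k. indicator (\<Union>i<k. A i) p :: real) \<longlonglongrightarrow> indicator (\<Union>i. A i) p" for p
        by (rule LIMSEQ_indicator_UN)
      show "indicator (\<Union>i<k. A i) \<in> borel_measurable P" for k
        using Union.IH by (intro borel_measurable_indicator) auto
      show "indicator (\<Union>i. A i) \<in> borel_measurable P"
        using Union.IH by (intro borel_measurable_indicator) auto
    qed (simp add: indicator_def)
    then show ?case using Union.IH by auto
  qed
  then show ?thesis ..
qed

text \<open>Integration theory is applied to the restriction of P to \<open>alg K\<close>, so that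
  the simple functions of the induction are built from sets of \<open>alg K\<close>, whose
  indicators are already approximable.\<close>

lemma approximable_integrable:
  assumes K: "conn_closed K" and f: "f \<in> borel_measurable (alg K)" "integrable P f"
  shows "approximable K f"
proof -
  have KF: "K \<subseteq> F {1..n}" using K by (simp add: conn_closed_def)
  note sub = subalgebra_alg[OF KF]
  have "integrable (restr_to_subalg P (alg K)) f" by (rule integrable_in_subalg[OF sub f])
  then show ?thesis
  proof (induction rule: integrable_induct)
    case (base A c)
    then have A: "A \<in> sets (alg K)" using sets_restr_to_subalg[OF sub] by simp
    then have "A \<in> sets P" using sub by (auto simp: subalgebra_def)
    then have int: "integrable P (indicator A :: _ \<Rightarrow> real)"
      by (intro integrable_const_bound[of _ 1]) auto
    have Lip: "\<bar>c * x - c * x'\<bar> \<le> \<bar>c\<bar> * (\<bar>x - x'\<bar> + \<bar>y - y'\<bar>)" for x y x' y' :: real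
      unfolding right_diff_distrib[symmetric] abs_mult by (intro mult_left_mono) auto
    have cont: "continuous_on UNIV (\<lambda>(x, y). c * x :: real)"
      unfolding case_prod_beta by (intro continuous_intros)
    note ind = approximable_indicator[OF K A]
    have "approximable K (\<lambda>p. c * indicator A p)"
      by (rule approximable_Lipschitz[OF K cont abs_ge_zero Lip ind int ind int])
    then show ?case by (simp add: mult.commute)
  next
    case (add f g)
    have "continuous_on UNIV (\<lambda>(x, y). x + y :: real)"
      unfolding case_prod_beta by (intro continuous_intros)
    then show ?case
      by (rule approximable_Lipschitz[OF K, of _ 1]) (use add integrable_from_subalg[OF sub] in auto)
  next
    case (lim f s)
    have f: "integrable P f" and s: "\<And>k. integrable P (s k)"
      using lim integrable_from_subalg[OF sub] by blast+
    show ?case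
    proof (rule approximable_dominated_limit[OF K])
      show "integrable P (\<lambda>p. 2 * \<bar>f p\<bar>)" using f by simp
      show "approximable K (s k)" for k by (rule lim.IH)
      show "\<bar>s k p\<bar> \<le> 2 * \<bar>f p\<bar>" if "p \<in> space P" for k p
        using lim.hyps(3) that by (simp add: space_restr_to_subalg)
      show "(\<lambda>k. s k p) \<longlonglongrightarrow> f p" if "p \<in> space P" for p
        using lim.hyps(2) that by (simp add: space_restr_to_subalg)
      show "s k \<in> borel_measurable P" for k using s by (rule borel_measurable_integrable)
      show "f \<in> borel_measurable P" using f by (rule borel_measurable_integrable)
    qed
  qed
qed

section \<open>Integrals as iterated expectations\<close>

lemma integral_eq_iter:
  assumes "\<phi> \<in> F {1..n}" "\<alpha> \<in> valuations N" "distinct is" "set is = {1..n}"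
  shows "(\<integral>p. p \<phi> \<partial>P) = iter is (\<lambda>\<beta>. fm_val N \<beta> \<phi>) \<alpha>"
  using assms integral_P[OF assms(1,2)] fubini[of "is" "sorted_list_of_set {1..n}" \<phi> \<alpha>] by simp

text \<open>
  By Fubini the variables outside \<open>u\<close> can be integrated last, and they then range over the
  elements of the model itself.
\<close>

lemma integral_le_if_instances_le:
  assumes u: "u \<subseteq> {1..n}" and \<theta>: "\<theta> \<in> F u" and \<psi>: "\<psi> \<in> F {1..n}"
    and le: "\<And>\<beta>. \<beta> \<in> valuations N \<Longrightarrow> \<bar>\<integral>p. p \<theta> * p (fm_inst (- ({X} \<times> u)) \<beta> \<psi>) \<partial>P\<bar> \<le> \<epsilon>"
  shows "\<bar>\<integral>p. p \<theta> * p \<psi> \<partial>P\<bar> \<le> \<epsilon>"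
proof -
  define us where "us = sorted_list_of_set u"
  \<comment> \<open>In the order \<open>ws @ us\<close> the variables outside u are outermost, that
    is, integrated last.\<close>
  define ws where "ws = sorted_list_of_set ({1..n} - u)"
  have "finite u" using u finite_subset by blast
  then have us: "set us = u" and dist: "distinct (ws @ us)" and set: "set (ws @ us) = {1..n}"
    using u by (auto simp: us_def ws_def)
  have cont: "continuous_on UNIV (\<lambda>(x, y). x * y :: real)"
    unfolding case_prod_beta by (intro continuous_intros)
  have mult: "Conn (*) \<theta> \<phi> \<in> F {1..n} \<and> (\<integral>p. p \<theta> * p \<phi> \<partial>P) = (\<integral>p. p (Conn (*) \<theta> \<phi>) \<partial>P)"
    if \<phi>: "\<phi> \<in> F {1..n}" for \<phi>
  proof -
    have \<theta>': "\<theta> \<in> F {1..n}" using \<theta> formulas_over_mono[OF u] by blast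
    note Conn = eval_Conn[OF conn_closed_formulas_over[OF order_refl] \<theta>' \<phi> cont]
    have "space P \<noteq> {}" by (rule not_empty)
    then show ?thesis
      using Conn by (auto intro!: Bochner_Integration.integral_cong)
  qed
  let ?\<Theta> = "Conn (*) \<theta> \<psi>"
  have bound: "\<bar>iter us (\<lambda>\<gamma>. fm_val N \<gamma> ?\<Theta>) \<beta>\<bar> \<le> \<epsilon>" if \<beta>: "\<beta> \<in> valuations N" for \<beta>
  proof -
    have "\<theta> \<in> formulas_with_params L N" "fm_fv \<theta> \<inter> - ({X} \<times> u) = {}"
      using \<theta> by (auto simp: formulas_over_iff)
    \<comment> \<open>All free variables of \<open>\<theta>\<close> lie in u, so instantiation
      affects only \<open>\<psi>\<close>.\<close>
    then have inst: "fm_inst (- ({X} \<times> u)) \<beta> ?\<Theta> = Conn (*) \<theta> (fm_inst (- ({X} \<times> u)) \<beta> \<psi>)"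
      by (simp add: fm_inst_ident)
    have "fm_inst (- ({X} \<times> u)) \<beta> \<psi> \<in> F {1..n}"
      using \<psi> fm_inst_with_params[OF _ \<beta>] by (auto simp: formulas_over_iff fm_fv_inst)
    note m = mult[OF this, folded inst]
    \<comment> \<open>The inner expectation at \<open>\<beta>\<close> is the full integral of the
      instance at \<open>\<beta>\<close>, in which the variables of ws no longer occur; this is the
      integral bounded by \<open>le\<close>.\<close>
    have "iter us (\<lambda>\<gamma>. fm_val N \<gamma> ?\<Theta>) \<beta>
        = iter (ws @ us) (\<lambda>\<gamma>. fm_val N \<gamma> (fm_inst (- ({X} \<times> u)) \<beta> ?\<Theta>)) \<beta>"
      using iter_inst[OF \<beta>, of ws us ?\<Theta>] unfolding us by simp
    also have "\<dots> = (\<integral>p. p (fm_inst (- ({X} \<times> u)) \<beta> ?\<Theta>) \<partial>P)"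
      using m by (intro integral_eq_iter[OF _ \<beta> dist set, symmetric]) blast
    also have "\<dots> = (\<integral>p. p \<theta> * p (fm_inst (- ({X} \<times> u)) \<beta> \<psi>) \<partial>P)"
      using m by simp
    finally show ?thesis using le[OF \<beta>] by simp
  qed
  obtain \<alpha> where \<alpha>: "\<alpha> \<in> valuations N" using valuations_nonempty[OF str] by blast
  have "(\<integral>p. p \<theta> * p \<psi> \<partial>P) = iter (ws @ us) (\<lambda>\<gamma>. fm_val N \<gamma> ?\<Theta>) \<alpha>"
    using mult[OF \<psi>] integral_eq_iter[OF _ \<alpha> dist set] by simp
  moreover have "?\<Theta> \<in> formulas_with_params L N"
    using mult[OF \<psi>] by (simp add: formulas_over_iff)
  ultimately show ?thesis using iter_bound[OF _ bound \<alpha>] by simp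
qed

section \<open>Orthogonality and the independent system\<close>

lemma conn_closed_measurable:
  assumes K: "conn_closed K" and C: "space C = space P"
  shows "conn_closed {\<phi> \<in> K. (\<lambda>p. p \<phi>) \<in> borel_measurable C}"
  unfolding conn_closed_def
proof (intro conjI allI impI ballI)
  show "{\<phi> \<in> K. (\<lambda>p. p \<phi>) \<in> borel_measurable C} \<subseteq> F {1..n}"
    using K by (auto simp: conn_closed_def)
next
  fix r
  have "(\<lambda>p. p (Const r)) \<in> borel_measurable C \<longleftrightarrow> (\<lambda>p. r) \<in> borel_measurable C"
    using type_Const by (intro measurable_cong) (auto simp: C space_P)
  then show "Const r \<in> {\<phi> \<in> K. (\<lambda>p. p \<phi>) \<in> borel_measurable C}"
    using K by (auto simp: conn_closed_def)
next
  fix c :: "real \<Rightarrow> real \<Rightarrow> real" and \<phi> \<psi>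
  assume c: "continuous_on UNIV (\<lambda>(x, y). c x y :: real)"
    and \<phi>: "\<phi> \<in> {\<phi> \<in> K. (\<lambda>p. p \<phi>) \<in> borel_measurable C}"
    and \<psi>: "\<psi> \<in> {\<phi> \<in> K. (\<lambda>p. p \<phi>) \<in> borel_measurable C}"
  have "(\<lambda>p. (p \<phi>, p \<psi>)) \<in> borel_measurable C" using \<phi> \<psi> by (intro borel_measurable_Pair) auto
  from measurable_compose[OF this borel_measurable_continuous_onI[OF c]]
  have "(\<lambda>p. c (p \<phi>) (p \<psi>)) \<in> borel_measurable C" by simp
  moreover have "(\<lambda>p. p (Conn c \<phi> \<psi>)) \<in> borel_measurable C \<longleftrightarrow> (\<lambda>p. c (p \<phi>) (p \<psi>)) \<in> borel_measurable C"
    using eval_Conn(2)[OF K _ _ c] \<phi> \<psi> by (intro measurable_cong) (auto simp: C)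
  moreover have "Conn c \<phi> \<psi> \<in> K" using K c \<phi> \<psi> unfolding conn_closed_def by blast
  ultimately show "Conn c \<phi> \<psi> \<in> {\<phi> \<in> K. (\<lambda>p. p \<phi>) \<in> borel_measurable C}" by simp
qed

text \<open>Instantiation commutes with connectives and fixes constants.\<close>

lemma conn_closed_instances:
  assumes K: "conn_closed K"
  shows "conn_closed {\<psi> \<in> F {1..n}. \<forall>\<beta>\<in>valuations N. fm_inst V \<beta> \<psi> \<in> K}"
  using K by (auto simp: conn_closed_def formulas_over_def)

text \<open>With h = E(f | C), the difference f - h is replaced by a formula \<open>\<theta>\<close>
  in u and the indicator of S by a formula \<open>\<psi>\<close> whose instances are C-measurable.
  Those instances are orthogonal to f - h, and \<open>integral_le_if_instances_le\<close> transfers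
  the resulting bound to \<open>\<psi>\<close>.\<close>

lemma integral_cond_exp_eq:
  assumes u: "u \<subseteq> {1..n}"
    and C: "space C = space P" "sets C = sets (alg (\<Union>w\<in>{w. w \<subset> u}. F w))"
    and f: "f \<in> borel_measurable (alg (F u))" "bounded (f ` space P)"
    and S: "S \<in> sets (alg (\<Union>v\<in>{v. v \<subseteq> {1..n} \<and> \<not> u \<subseteq> v}. F v))"
  shows "(\<integral>p. indicator S p * f p \<partial>P) = (\<integral>p. indicator S p * real_cond_exp P C f p \<partial>P)"
proof -
  have Fu: "F u \<subseteq> F {1..n}" by (rule formulas_over_mono[OF u])
  have "(\<Union>w\<in>{w. w \<subset> u}. F w) \<subseteq> F {1..n}" using u formulas_over_mono by blast
  from subalgebra_alg[OF this] have subC: "subalgebra P C" using C by (simp add: subalgebra_def)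
  interpret C: finite_measure_subalgebra P C by unfold_locales (fact subC)
  define h where "h = real_cond_exp P C f"
  \<comment> \<open>The union of the \<open>F w\<close> is not closed under connectives, since these
    mix variables of different w. The C-measurable formulas in u form a closed set that contains
    it.\<close>
  define KC where "KC = {\<phi> \<in> F u. (\<lambda>p. p \<phi>) \<in> borel_measurable C}"
  define KB where "KB = {\<psi> \<in> F {1..n}. \<forall>\<beta>\<in>valuations N. fm_inst (- ({X} \<times> u)) \<beta> \<psi> \<in> KC}"
  have KC: "conn_closed KC"
    unfolding KC_def by (rule conn_closed_measurable[OF conn_closed_formulas_over[OF u] C(1)])
  have KB: "conn_closed KB" unfolding KB_def by (rule conn_closed_instances[OF KC])
  have lower: "F w \<subseteq> KC" if "w \<subset> u" for w
  proof
    fix \<phi> assume \<phi>: "\<phi> \<in> F w"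
    then have "(\<lambda>p. p \<phi>) \<in> borel_measurable (alg (\<Union>w\<in>{w. w \<subset> u}. F w))"
      using that by (intro measurable_evaluation) blast
    then have "(\<lambda>p. p \<phi>) \<in> borel_measurable C" using measurable_cong_sets[OF C(2) refl] by blast
    then show "\<phi> \<in> KC" using \<phi> that formulas_over_mono[of w u] by (auto simp: KC_def)
  qed
  \<comment> \<open>Instances of a formula in v have their variables in \<open>v \<inter> u\<close>,
    a proper subset of u because u is not contained in v.\<close>
  have other: "F v \<subseteq> KB" if "v \<subseteq> {1..n}" "\<not> u \<subseteq> v" for v
  proof
    fix \<psi> assume \<psi>: "\<psi> \<in> F v"
    have "fm_inst (- ({X} \<times> u)) \<beta> \<psi> \<in> F (v \<inter> u)" if "\<beta> \<in> valuations N" for \<beta>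
      using \<psi> fm_inst_with_params[OF _ that] by (auto simp: formulas_over_iff fm_fv_inst)
    moreover have "v \<inter> u \<subset> u" using that by blast
    ultimately show "\<psi> \<in> KB" using lower \<psi> that formulas_over_mono[of v "{1..n}"] by (auto simp: KB_def)
  qed
  have algC: "sets C \<subseteq> sets (alg KC)"
    unfolding C(2) using lower by (intro sets_evaluation_algebra_mono) blast
  have "(\<Union>v\<in>{v. v \<subseteq> {1..n} \<and> \<not> u \<subseteq> v}. F v) \<subseteq> KB"
    by (rule UN_least) (use other in simp)
  then have S_KB: "S \<in> sets (alg KB)"
    by (rule subsetD[OF sets_evaluation_algebra_mono S])
  have SP: "S \<in> sets P"
    using S_KB KB subalgebra_alg[of KB] by (auto simp: conn_closed_def subalgebra_def)
  have fP: "f \<in> borel_measurable P" by (rule measurable_from_subalg[OF subalgebra_alg[OF Fu] f(1)])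
  obtain c where "\<And>p. p \<in> space P \<Longrightarrow> \<bar>f p\<bar> \<le> c" using f(2) by (auto simp: bounded_iff)
  then have fi: "integrable P f" using fP by (intro integrable_const_bound[of _ c]) auto
  have hi: "integrable P h" unfolding h_def by (rule C.real_cond_exp_int(1)[OF fi])
  have "h \<in> borel_measurable C" by (simp add: h_def)
  \<comment> \<open>Hence h is approximated by formulas in the variables of u, and subtracting one
    from an approximation of f keeps \<open>\<theta>\<close> in \<open>F u\<close>.\<close>
  then have h_KC: "h \<in> borel_measurable (alg KC)"
    using algC by (auto simp: measurable_def C(1) space_P)
  \<comment> \<open>Write f - h as \<open>d + \<theta>\<close>, where d has L1 norm at most
    \<open>2 * \<epsilon>\<close>. The bound adds \<open>2 * \<epsilon>\<close> for the indicator
    against d, \<open>\<epsilon>\<close> for \<open>\<theta>\<close> against the error of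
    \<open>\<psi>\<close>, and \<open>2 * \<epsilon>\<close> for \<open>\<theta>\<close> against
    \<open>\<psi>\<close>.\<close>
  have le: "\<bar>\<integral>p. indicator S p * (f p - h p) \<partial>P\<bar> \<le> 5 * \<epsilon>" if "\<epsilon> > 0" for \<epsilon>
  proof -
    obtain \<phi> where \<phi>: "\<phi> \<in> F u" "(\<integral>p. \<bar>f p - p \<phi>\<bar> \<partial>P) < \<epsilon>"
      using approximable_integrable[OF conn_closed_formulas_over[OF u] f(1) fi] \<open>\<epsilon> > 0\<close>
      unfolding approximable_def by blast
    obtain \<eta> where \<eta>: "\<eta> \<in> KC" "(\<integral>p. \<bar>h p - p \<eta>\<bar> \<partial>P) < \<epsilon>"
      using approximable_integrable[OF KC h_KC hi] \<open>\<epsilon> > 0\<close> unfolding approximable_def by blast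
    have \<eta>u: "\<eta> \<in> F u" using \<eta>(1) by (simp add: KC_def)
    define \<theta> where "\<theta> = Conn (-) \<phi> \<eta>"
    have "continuous_on UNIV (\<lambda>(x, y). x - y :: real)"
      unfolding case_prod_beta by (intro continuous_intros)
    note minus = eval_Conn[OF conn_closed_formulas_over[OF u] \<phi>(1) \<eta>u this, folded \<theta>_def]
    have \<theta>: "\<theta> \<in> F u" "\<And>p. p \<in> space P \<Longrightarrow> p \<theta> = p \<phi> - p \<eta>"
      using minus not_empty by auto
    have int: "integrable P (\<lambda>p. p \<phi>)" "integrable P (\<lambda>p. p \<eta>)" "integrable P (\<lambda>p. p \<theta>)"
      using \<phi>(1) \<eta>u \<theta>(1) Fu eval_integrable by blast+
    define d where "d p = (f p - p \<phi>) + (p \<eta> - h p)" for p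
    have di: "integrable P d"
      unfolding d_def by (intro Bochner_Integration.integrable_add Bochner_Integration.integrable_diff int fi hi)
    have "(\<integral>p. \<bar>d p\<bar> \<partial>P) \<le> (\<integral>p. \<bar>f p - p \<phi>\<bar> + \<bar>h p - p \<eta>\<bar> \<partial>P)"
      using int fi hi by (intro integral_mono') (auto simp: d_def)
    also have "\<dots> = (\<integral>p. \<bar>f p - p \<phi>\<bar> \<partial>P) + (\<integral>p. \<bar>h p - p \<eta>\<bar> \<partial>P)"
      using int fi hi by (intro Bochner_Integration.integral_add) auto
    finally have d: "(\<integral>p. \<bar>d p\<bar> \<partial>P) \<le> 2 * \<epsilon>" using \<phi>(2) \<eta>(2) by linarith
    have fh: "f p - h p = d p + p \<theta>" if "p \<in> space P" for p
      using \<theta>(2)[OF that] by (simp add: d_def)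
    obtain B where B: "\<And>p. p \<in> space P \<Longrightarrow> \<bar>p \<theta>\<bar> \<le> B" "B > 0"
    proof -
      obtain B0 where B0: "\<And>p. p \<in> space P \<Longrightarrow> \<bar>p \<theta>\<bar> \<le> B0" using eval_bounded \<theta>(1) Fu by blast
      have "\<bar>p \<theta>\<bar> \<le> \<bar>B0\<bar> + 1" if "p \<in> space P" for p using B0[OF that] by linarith
      moreover have "0 < \<bar>B0\<bar> + 1" by (intro add_nonneg_pos abs_ge_zero zero_less_one)
      ultimately show ?thesis by (rule that)
    qed
    \<comment> \<open>This choice comes after the bound B on \<open>\<theta>\<close>, so that the
      error remains below \<open>\<epsilon>\<close> when multiplied by
      \<open>\<theta>\<close>.\<close>
    obtain \<psi>0 where \<psi>0: "\<psi>0 \<in> KB" "(\<integral>p. \<bar>indicator S p - p \<psi>0\<bar> \<partial>P) < \<epsilon> / B"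
      using approximable_indicator[OF KB S_KB] \<open>\<epsilon> > 0\<close> \<open>B > 0\<close> unfolding approximable_def
      by (meson divide_pos_pos)
    \<comment> \<open>Clamping to the unit interval brings the values no further from an indicator,
      and since instantiation preserves the outer connective, every instance is bounded by 1 as
      well.\<close>
    define \<psi> where "\<psi> = Conn (\<lambda>x y. max 0 (min 1 x)) \<psi>0 \<psi>0"
    have "continuous_on UNIV (\<lambda>(x, y :: real). max 0 (min 1 x) :: real)"
      unfolding case_prod_beta by (intro continuous_intros)
    note clamp = eval_Conn[OF KB \<psi>0(1) \<psi>0(1) this, folded \<psi>_def]
    have \<psi>: "\<psi> \<in> KB" "\<And>p. p \<in> space P \<Longrightarrow> p \<psi> = max 0 (min 1 (p \<psi>0))"
      using clamp not_empty by auto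
    have \<psi>F: "\<psi> \<in> F {1..n}" "\<psi>0 \<in> F {1..n}" using \<psi>(1) \<psi>0(1) by (auto simp: KB_def)
    have Si: "integrable P (indicator S :: _ \<Rightarrow> real)"
      using SP by (intro integrable_const_bound[of _ 1]) auto
    have "(\<integral>p. \<bar>indicator S p - p \<psi>\<bar> \<partial>P) \<le> (\<integral>p. \<bar>indicator S p - p \<psi>0\<bar> \<partial>P)"
    proof (rule integral_mono')
      show "integrable P (\<lambda>p. \<bar>indicator S p - p \<psi>0\<bar>)"
        by (intro integrable_abs Bochner_Integration.integrable_diff Si eval_integrable \<psi>F)
    qed (auto simp: \<psi>(2) indicator_def)
    then have S\<psi>: "(\<integral>p. \<bar>indicator S p - p \<psi>\<bar> \<partial>P) \<le> \<epsilon> / B" using \<psi>0(2) by linarith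
    have Si\<psi>: "integrable P (\<lambda>p. indicator S p - p \<psi>)"
      using Si eval_integrable[OF \<psi>F(1)] by simp
    have "\<bar>\<integral>p. p \<theta> * p \<psi> \<partial>P\<bar> \<le> 2 * \<epsilon>"
    proof (rule integral_le_if_instances_le[OF u \<theta>(1) \<psi>F(1)])
      fix \<beta> assume \<beta>: "\<beta> \<in> valuations N"
      let ?\<psi> = "fm_inst (- ({X} \<times> u)) \<beta> \<psi>"
      have K: "?\<psi> \<in> KC" using \<psi>(1) \<beta> by (simp add: KB_def)
      then have FF: "?\<psi> \<in> F {1..n}" using KC by (auto simp: conn_closed_def)
      have mC: "(\<lambda>p. p ?\<psi>) \<in> borel_measurable C" using K by (simp add: KC_def)
      have mP: "(\<lambda>p. p ?\<psi>) \<in> borel_measurable P" by (rule eval_measurable[OF FF])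
      have le1: "\<bar>p ?\<psi>\<bar> \<le> 1" if "p \<in> space P" for p
      proof (rule type_bound[OF _ FF])
        show "p \<in> types L N X {1..n}" using that by (simp only: space_P)
        have "\<bar>max 0 (min 1 x)\<bar> \<le> 1" for x :: real by (smt (verit))
        then show "\<bar>fm_val N \<alpha> ?\<psi>\<bar> \<le> 1" for \<alpha>
          by (simp only: \<psi>_def fm_inst.simps fm_val.simps)
      qed
      have pi: "integrable P (\<lambda>p. p ?\<psi> * k p)" if "integrable P k" for k
        by (rule integrable_bounded_mult[OF that mP]) (rule le1)
      \<comment> \<open>The instance is bounded and C-measurable, hence orthogonal to f - h. Its
        integral against \<open>\<theta>\<close> is therefore minus its integral against d, at most
        \<open>2 * \<epsilon>\<close> in absolute value, uniformly in
        \<open>\<beta>\<close>.\<close>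
      have "(\<integral>p. p ?\<psi> * h p \<partial>P) = (\<integral>p. p ?\<psi> * f p \<partial>P)"
        unfolding h_def by (rule C.real_cond_exp_intg(2)[of "\<lambda>p. p ?\<psi>" f, OF pi[OF fi] mC fP])
      then have "0 = (\<integral>p. p ?\<psi> * (f p - h p) \<partial>P)"
        using pi[OF fi] pi[OF hi] by (simp add: right_diff_distrib)
      also have "\<dots> = (\<integral>p. p ?\<psi> * d p + p ?\<psi> * p \<theta> \<partial>P)"
        by (intro Bochner_Integration.integral_cong) (auto simp: fh distrib_left)
      also have "\<dots> = (\<integral>p. p ?\<psi> * d p \<partial>P) + (\<integral>p. p ?\<psi> * p \<theta> \<partial>P)"
        by (intro Bochner_Integration.integral_add pi di int)
      finally have "(\<integral>p. p \<theta> * p ?\<psi> \<partial>P) = - (\<integral>p. p ?\<psi> * d p \<partial>P)"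
        by (simp add: mult.commute)
      moreover have "\<bar>\<integral>p. p ?\<psi> * d p \<partial>P\<bar> \<le> 1 * (\<integral>p. \<bar>d p\<bar> \<partial>P)"
        by (rule integral_bounded_mult_le[OF di]) (rule le1, assumption, rule zero_le_one)
      ultimately show "\<bar>\<integral>p. p \<theta> * p ?\<psi> \<partial>P\<bar> \<le> 2 * \<epsilon>"
        using d by simp
    qed
    moreover have "\<bar>\<integral>p. p \<theta> * (indicator S p - p \<psi>) \<partial>P\<bar> \<le> \<epsilon>"
    proof -
      have "\<bar>\<integral>p. p \<theta> * (indicator S p - p \<psi>) \<partial>P\<bar> \<le> B * (\<integral>p. \<bar>indicator S p - p \<psi>\<bar> \<partial>P)"
        using B by (intro integral_bounded_mult_le[OF Si\<psi>]) auto
      also have "\<dots> \<le> B * (\<epsilon> / B)" using S\<psi> B(2) by (intro mult_left_mono) auto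
      finally show ?thesis using B(2) by simp
    qed
    moreover have "\<bar>\<integral>p. indicator S p * d p \<partial>P\<bar> \<le> 2 * \<epsilon>"
      using integral_bounded_mult_le[OF di, of "indicator S" 1] d by simp
    moreover have "(\<integral>p. indicator S p * (f p - h p) \<partial>P)
      = (\<integral>p. indicator S p * d p \<partial>P) + ((\<integral>p. p \<theta> * (indicator S p - p \<psi>) \<partial>P) + (\<integral>p. p \<theta> * p \<psi> \<partial>P))"
    proof -
      have \<theta>m: "(\<lambda>p. p \<theta>) \<in> borel_measurable P" using int(3) by auto
      have 1: "integrable P (\<lambda>p. indicator S p * d p)"
        using SP by (intro integrable_bounded_mult[OF di, of _ 1]) auto
      have 2: "integrable P (\<lambda>p. p \<theta> * (indicator S p - p \<psi>))"
        by (rule integrable_bounded_mult[OF Si\<psi> \<theta>m]) (rule B(1))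
      have 3: "integrable P (\<lambda>p. p \<theta> * p \<psi>)"
        by (rule integrable_bounded_mult[OF eval_integrable[OF \<psi>F(1)] \<theta>m]) (rule B(1))
      have "(\<integral>p. indicator S p * (f p - h p) \<partial>P)
        = (\<integral>p. indicator S p * d p + (p \<theta> * (indicator S p - p \<psi>) + p \<theta> * p \<psi>) \<partial>P)"
        by (intro Bochner_Integration.integral_cong) (auto simp: fh algebra_simps)
      then show ?thesis using 1 2 3 by simp
    qed
    ultimately show ?thesis by linarith
  qed
  have "\<bar>\<integral>p. indicator S p * (f p - h p) \<partial>P\<bar> \<le> 0"
  proof (rule field_le_epsilon)
    fix e :: real assume "e > 0"
    with le[of "e / 5"] show "\<bar>\<integral>p. indicator S p * (f p - h p) \<partial>P\<bar> \<le> 0 + e" by simp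
  qed
  then have "(\<integral>p. indicator S p * (f p - h p) \<partial>P) = 0" by simp
  moreover have "integrable P (\<lambda>p. indicator S p * f p)" "integrable P (\<lambda>p. indicator S p * h p)"
    using SP by (auto intro!: integrable_bounded_mult[OF fi, of _ 1] integrable_bounded_mult[OF hi, of _ 1])
  ultimately show ?thesis by (simp add: right_diff_distrib h_def)
qed

lemma independent_system_formula_algebra: "independent_system P n (formula_algebra L N X n)"
  unfolding independent_system_def
proof (intro allI impI)
  fix u assume u: "u \<subseteq> {1..n}"
  let ?A = "formula_algebra L N X n" and ?VB = "{v. v \<subseteq> {1..n} \<and> \<not> u \<subseteq> v}" and ?VC = "{w. w \<subset> u}"
  let ?B = "generated_algebra P (?A ` ?VB)" and ?C = "generated_algebra P (?A ` ?VC)"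
  have B: "sets ?B = sets (alg (\<Union>v\<in>?VB. F v))"
    by (rule sets_generated_formula_algebras[OF space_P]) auto
  have C: "sets ?C = sets (alg (\<Union>w\<in>?VC. F w))"
    by (rule sets_generated_formula_algebras[OF space_P]) (use u in auto)
  have sp: "space (generated_algebra P \<A>) = space P" for \<A>
    by (simp add: generated_algebra_def space_measure_of_conv)
  have sub: "K \<subseteq> F {1..n} \<Longrightarrow> sets (alg K) \<subseteq> sets P" for K
    using subalgebra_alg[of K] by (simp add: subalgebra_def)
  have "independent_over P (?A u) ?B ?C"
  proof (rule independent_over_if_integral_eq)
    show "prob_space P" by (rule prob_space_axioms)
    show "subalgebra P (?A u)"
      unfolding formula_algebra_eq[OF u] by (rule subalgebra_alg[OF formulas_over_mono[OF u]])
    show "subalgebra P ?B"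
      unfolding subalgebra_def sp B using formulas_over_mono by (intro conjI refl sub) blast
    show "subalgebra P ?C"
      unfolding subalgebra_def sp C using formulas_over_mono u by (intro conjI refl sub) blast
    \<comment> \<open>A proper subset of u does not contain u, so the formulas generating
      \<open>?C\<close> are among those generating \<open>?B\<close>.\<close>
    show "subalgebra ?B ?C"
      unfolding subalgebra_def sp B C using u
      by (intro conjI refl sets_evaluation_algebra_mono) blast
    fix f :: "_ \<Rightarrow> real" and S
    assume "f \<in> borel_measurable (?A u)" "bounded (f ` space P)" "S \<in> sets ?B"
    then show "(\<integral>p. indicator S p * f p \<partial>P) = (\<integral>p. indicator S p * real_cond_exp P ?C f p \<partial>P)"
      unfolding formula_algebra_eq[OF u] B by (intro integral_cond_exp_eq[OF u sp C])
  qed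
  moreover have "{?A v |v. v \<subseteq> {1..n} \<and> \<not> u \<subseteq> v} = ?A ` ?VB" "{?A w |w. w \<subset> u} = ?A ` ?VC"
    by auto
  ultimately show "independent_over P (?A u)
      (generated_algebra P {?A v |v. v \<subseteq> {1..n} \<and> \<not> u \<subseteq> v})
      (generated_algebra P {?A w |w. w \<subset> u})" by simp
qed

end

theorem mainTheorem15:
  fixes L :: "('s, 'f, 'p) language"
    and T :: "('s, 'f, 'p, 'a) fm set"
    and X :: 's
    and E :: "('s, 'f, 'p, 'a) struct \<Rightarrow> ('a \<Rightarrow> real) \<Rightarrow> real"
    and M :: "('s, 'f, 'p, 'a) struct"
    and n :: nat
    and P :: "(('s, 'f, 'p, 'a) fm \<Rightarrow> real) measure"
  assumes "countable_language L"
    and "complete_theory L T"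
    and "definable_measure L T X E"
    and "satisfies_fubini L T X E"
    and "is_model L T M"
    and "induced_measure L M X (E M) {1..n} P"
  shows "independent_system P n (formula_algebra L M X n)"
proof -
  have E: "expectation L M X (E M)"
  proof
    show "is_struct L M" using assms(5) by (simp add: is_model_def)
    show "E M g = E M h" if "\<And>a. a \<in> dom M X \<Longrightarrow> g a = h a" for g h
      using assms(3,5) that unfolding definable_measure_def by blast
    show "E M (\<lambda>a. c * g a + d * h a) = c * E M g + d * E M h"
      if "g \<in> definable_functions L M X" "h \<in> definable_functions L M X" for g h c d
      using assms(3,5) that unfolding definable_measure_def by blast
    show "0 \<le> E M g" if "g \<in> definable_functions L M X" "\<And>a. a \<in> dom M X \<Longrightarrow> 0 \<le> g a" for g
      using assms(3,5) that unfolding definable_measure_def by blast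
    show "E M (\<lambda>a. 1) = 1"
      using assms(3,5) unfolding definable_measure_def by blast
    show "\<exists>\<psi>\<in>L_formulas L. \<forall>\<alpha>\<in>valuations M.
        \<bar>E M (\<lambda>a. fm_val M (\<alpha>((X, i) := a)) \<phi>) - fm_val M \<alpha> \<psi>\<bar> \<le> \<epsilon>"
      if "\<phi> \<in> L_formulas L" "0 < \<epsilon>" for \<phi> i \<epsilon>
      using assms(3,5) that unfolding definable_measure_def by meson
  qed
  have prob: "prob_space P" using assms(6) by (simp add: induced_measure_def)
  have "type_measure L M X (E M) P n"
    using E prob
  proof (rule type_measure.intro[OF _ _ type_measure_axioms.intro])
    show "space P = types L M X {1..n}" "sets P = sets (type_space L M X {1..n})"
      using assms(6) by (simp_all add: induced_measure_def)
    show "(\<integral>p. p \<phi> \<partial>P) = iterated_expectation X (E M) (sorted_list_of_set {1..n}) (\<lambda>\<beta>. fm_val M \<beta> \<phi>) \<alpha>"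
      if "\<phi> \<in> formulas_over L M X {1..n}" "\<alpha> \<in> valuations M" for \<phi> \<alpha>
      using assms(6) that unfolding induced_measure_def by blast
    show "iterated_expectation X (E M) is (\<lambda>\<beta>. fm_val M \<beta> \<phi>) \<alpha>
        = iterated_expectation X (E M) js (\<lambda>\<beta>. fm_val M \<beta> \<phi>) \<alpha>"
      if "distinct is" "distinct js" "set is = set js" "\<phi> \<in> formulas_over L M X (set is)"
        "\<alpha> \<in> valuations M" for "is" js \<phi> \<alpha>
      using assms(4,5) that unfolding satisfies_fubini_def by blast
  qed
  then show ?thesis by (rule type_measure.independent_system_formula_algebra)
qed

end
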